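(* For every integer $t\geq 10^{391}+3$ and every real $\varepsilon>0$, $$s_t(n)\geq n^{\,1-\frac{1+\varepsilon}{t-10^{391}-1+\varepsilon}}$$ for all sufficiently large $n$.
   Context: All graphs are finite and simple; $\delta(F)$ denotes the minimum degree and $\chi(F)$ the chromatic number of a graph $F$. For an integer $t\geq5$, the extremal deficiency is $$s_t(n):=\frac{n}{3}-\max\{\delta(F): |V(F)|=n,\ F\text{ is triangle-free},\ \chi(F)\geq t\},$$ which is defined for all sufficiently large $n$ (those for which such an $F$ exists). *)

theory Defs
  imports Complex_Main "Graph_Theory.Graph_Theory"
begin

(* A finite simple graph is a pair_graph: finitely many vertices, no loops, and a symmetric arc
   relation, so that each edge {u, v} appears as the two arcs (u, v) and (v, u).  The degree of a
   vertex is therefore its out_degree. *)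

definition min_degree :: "'a pair_pre_digraph \<Rightarrow> nat" where
  "min_degree F = Min (out_degree F ` pverts F)"

definition triangle_free :: "'a pair_pre_digraph \<Rightarrow> bool" where
  "triangle_free F \<longleftrightarrow>
     \<not> (\<exists>u v w. (u, v) \<in> parcs F \<and> (v, w) \<in> parcs F \<and> (u, w) \<in> parcs F)"

definition proper_colouring :: "'a pair_pre_digraph \<Rightarrow> nat \<Rightarrow> ('a \<Rightarrow> nat) \<Rightarrow> bool" where
  "proper_colouring F k c \<longleftrightarrow>
     c ` pverts F \<subseteq> {..<k} \<and> (\<forall>(u, v) \<in> parcs F. c u \<noteq> c v)"

definition chromatic_number :: "'a pair_pre_digraph \<Rightarrow> nat" where
  "chromatic_number F = (LEAST k. \<exists>c. proper_colouring F k c)"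

(* Every finite graph is isomorphic to one whose vertices are natural numbers. *)
definition admissible_graphs :: "nat \<Rightarrow> nat \<Rightarrow> nat pair_pre_digraph set" where
  "admissible_graphs t n =
     {F. pair_graph F \<and> card (pverts F) = n \<and> triangle_free F \<and> chromatic_number F \<ge> t}"

(* Meaningful only where admissible_graphs t n is nonempty; elsewhere the Max is unspecified.
   The Max ranges over a finite set of degrees, even though there are infinitely many labelled
   graphs: see finite_min_degrees. *)
definition extremal_deficiency :: "nat \<Rightarrow> nat \<Rightarrow> real" where
  "extremal_deficiency t n = real n / 3 - real (Max (min_degree ` admissible_graphs t n))"

lemma out_degree_le_card:
  assumes "pair_graph F"
  shows "out_degree F v \<le> card (pverts F)"
proof -
  interpret pair_graph F by fact
  have "out_arcs F v \<subseteq> Pair v ` pverts F"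
    by (auto simp: out_arcs_def dest: in_arcsD2)
  then have "card (out_arcs F v) \<le> card (Pair v ` pverts F)"
    by (intro card_mono) auto
  also have "\<dots> \<le> card (pverts F)"
    by (intro card_image_le) auto
  finally show ?thesis
    by (simp add: out_degree_def)
qed

lemma finite_min_degrees: "finite (min_degree ` admissible_graphs t n)"
proof (cases "n = 0")
  case True
  have "min_degree F = Min {}" if "F \<in> admissible_graphs t n" for F
  proof -
    from that have "pair_graph F" "card (pverts F) = 0"
      using True by (auto simp: admissible_graphs_def)
    then interpret pair_graph F by simp
    from \<open>card (pverts F) = 0\<close> have "pverts F = {}" by simp
    then show ?thesis by (simp add: min_degree_def)
  qed
  then have "min_degree ` admissible_graphs t n \<subseteq> {Min {}}" by blast
  then show ?thesis by (rule finite_subset) simp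
next
  case False
  have "min_degree F \<le> n" if "F \<in> admissible_graphs t n" for F
  proof -
    from that have F: "pair_graph F" and n: "card (pverts F) = n"
      by (auto simp: admissible_graphs_def)
    from n False obtain v where "v \<in> pverts F" by fastforce
    moreover have "finite (pverts F)" using n False card_ge_0_finite by auto
    ultimately have "min_degree F \<le> out_degree F v" by (auto simp: min_degree_def)
    also have "\<dots> \<le> n" using out_degree_le_card[OF F] n by simp
    finally show ?thesis .
  qed
  then have "min_degree ` admissible_graphs t n \<subseteq> {..n}" by auto
  then show ?thesis by (rule finite_subset) simp
qed

end

theory Submission
  imports Defs "HOL-Library.Nat_Bijection" "HOL-Real_Asymp.Real_Asymp"
begin

text \<open>
  Let F be triangle-free on n vertices with minimum degree at least n/3 - s. Write A for its
  adjacency matrix. If A is replaced by its projection to a bounded number of directions and the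
  coordinates of A applied to the neighbourhoods are rounded, the vertices fall into at most
  10^390 classes such that neighbourhoods of vertices in the same class have almost the same codegree
  function. Either this is a proper colouring, or it has an edge uv inside a class. Then there are
  few edges between the neighbourhoods of u and v, and almost all of their union is a
  stable set with nearly 2n/3 vertices.

  In the second case let B be a maximal stable set containing it. The vertices outside B either
  see more than n/3 + 2s vertices of B, and these form a stable set, or they form a set H with no
  edges to the former. Every vertex of H sees about half of B and adjacent ones see disjoint
  parts, and counting degrees shows that odd cycles in H have length of order at least n/s. By an
  argument of Kierstead, Szemeredi and Trotter, H is then (k+1)-colourable, since n/s
  exceeds n^(1/k) by a power of n.
\<close>

section \<open>Stable sets and colourings of an arc relation\<close>

definition stable_set :: "('a \<times> 'a) set \<Rightarrow> 'a set \<Rightarrow> bool" where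
  "stable_set E U \<longleftrightarrow> (\<forall>x\<in>U. \<forall>y\<in>U. (x, y) \<notin> E)"

text \<open>Only arcs inside \<open>U\<close> matter, so a recursion can shrink \<open>U\<close>
  while the relation \<open>E\<close> stays fixed.\<close>

definition colourable :: "('a \<times> 'a) set \<Rightarrow> 'a set \<Rightarrow> nat \<Rightarrow> bool" where
  "colourable E U k \<longleftrightarrow>
     (\<exists>c::'a \<Rightarrow> nat. (\<forall>x\<in>U. c x < k) \<and> (\<forall>x\<in>U. \<forall>y\<in>U. (x, y) \<in> E \<longrightarrow> c x \<noteq> c y))"

lemma colourable_mono: "colourable E U k \<Longrightarrow> k \<le> l \<Longrightarrow> colourable E U l"
  unfolding colourable_def by (auto 0 3 intro: less_le_trans)

lemma colourable_Un_stable: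
  assumes "colourable E U k" "stable_set E S"
  shows "colourable E (U \<union> S) (Suc k)"
proof -
  from assms(1) obtain c :: "'a \<Rightarrow> nat"
    where c: "\<forall>x\<in>U. c x < k" "\<forall>x\<in>U. \<forall>y\<in>U. (x, y) \<in> E \<longrightarrow> c x \<noteq> c y"
    unfolding colourable_def by blast
  let ?c = "\<lambda>x. if x \<in> S then k else c x"
  have "?c x < Suc k" if "x \<in> U \<union> S" for x
    using that c(1) by (auto intro: less_SucI)
  moreover have "?c x \<noteq> ?c y" if "x \<in> U \<union> S" "y \<in> U \<union> S" "(x, y) \<in> E" for x y
    using that c assms(2) unfolding stable_set_def by (metis UnE less_irrefl)
  ultimately show ?thesis
    unfolding colourable_def by (intro exI[of _ ?c]) auto
qed

lemma relpow_subset_mono: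
  fixes E F :: "('a \<times> 'a) set"
  shows "F \<subseteq> E \<Longrightarrow> F ^^ n \<subseteq> E ^^ n"
  by (induction n) auto

lemma sym_relpow:
  fixes E :: "('a \<times> 'a) set"
  assumes "sym E" "(x, y) \<in> E ^^ n"
  shows "(y, x) \<in> E ^^ n"
  using assms(2)
proof (induction n arbitrary: y)
  case (Suc n)
  then obtain z where "(x, z) \<in> E ^^ n" "(z, y) \<in> E" by auto
  then show ?case using Suc.IH assms(1) by (meson relpow_Suc_I2 symD)
qed simp

section \<open>Graphs without short odd closed walks\<close>

definition walk_ball :: "('a \<times> 'a) set \<Rightarrow> 'a \<Rightarrow> nat \<Rightarrow> 'a set" where
  "walk_ball E v i = {x. \<exists>j\<le>i. (v, x) \<in> E ^^ j}"

lemma walk_ball_mono: "i \<le> j \<Longrightarrow> walk_ball E v i \<subseteq> walk_ball E v j"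
  unfolding walk_ball_def by (auto intro: order_trans)

lemma walk_ball_0 [simp]: "walk_ball E v 0 = {v}"
  unfolding walk_ball_def by auto

lemma walk_ball_step: "x \<in> walk_ball E v i \<Longrightarrow> (x, y) \<in> E \<Longrightarrow> y \<in> walk_ball E v (Suc i)"
  unfolding walk_ball_def by (auto intro: relpow_Suc_I)

lemma walk_ball_subset:
  assumes "v \<in> U" "E \<subseteq> U \<times> U"
  shows "walk_ball E v i \<subseteq> U"
proof -
  have "(v, x) \<in> E ^^ j \<Longrightarrow> x \<in> U" for x j
    using assms by (cases j) auto
  then show ?thesis unfolding walk_ball_def by auto
qed

text \<open>Otherwise every two steps enlarge the ball by a factor of at least
  \<open>1 + 1 / m\<close>, and after \<open>q\<close> double steps it outgrows \<open>U\<close>.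
  Two layers are compared at once because vertices of both may be discarded when a ball is cut
  out.\<close>

lemma slow_growth_index:
  assumes fin: "finite U" and v: "v \<in> U" and E: "E \<subseteq> U \<times> U"
    and big: "real (card U) < (1 + 1 / real m) ^ q" and m: "m > 0"
  shows "\<exists>i \<le> 2 * q. m * card (walk_ball E v (i + 2) - walk_ball E v i) \<le> card (walk_ball E v i)"
proof (rule ccontr)
  assume neg: "\<not> ?thesis"
  let ?B = "walk_ball E v"
  have finB: "finite (?B i)" for i
    using walk_ball_subset[OF v E] fin finite_subset by blast
  have "(1 + 1 / real m) ^ j \<le> real (card (?B (2 * j)))" if "j \<le> q" for j
    using that
  proof (induction j)
    case 0
    then show ?case by simp
  next
    case (Suc j)
    have sub: "?B (2 * j) \<subseteq> ?B (2 * j + 2)" by (rule walk_ball_mono) simp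
    have "2 * j \<le> 2 * q" using Suc.prems by simp
    with neg have "card (?B (2 * j)) < m * card (?B (2 * j + 2) - ?B (2 * j))"
      by (meson not_le)
    then have "real (card (?B (2 * j))) \<le> real m * real (card (?B (2 * j + 2) - ?B (2 * j)))"
      unfolding of_nat_mult[symmetric] of_nat_le_iff by (rule less_imp_le)
    also have "real (card (?B (2 * j + 2) - ?B (2 * j)))
        = real (card (?B (2 * j + 2))) - real (card (?B (2 * j)))"
      using card_Diff_subset[OF finB sub] card_mono[OF finB sub] of_nat_diff by metis
    finally have "(1 + 1 / real m) * real (card (?B (2 * j))) \<le> real (card (?B (2 * j + 2)))"
      using m by (simp add: field_simps)
    moreover have "(1 + 1 / real m) * (1 + 1 / real m) ^ j \<le> (1 + 1 / real m) * real (card (?B (2 * j)))"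
      using Suc by (intro mult_left_mono) auto
    ultimately show ?case by simp
  qed
  from this[of q] have "(1 + 1 / real m) ^ q \<le> real (card (?B (2 * q)))" by simp
  also have "\<dots> \<le> real (card U)"
    using card_mono[OF fin walk_ball_subset[OF v E]] by simp
  finally show False using big by simp
qed

text \<open>The set D is what remains after one colour P is used up; Z can later be given any
  colour that also occurs in D, which is why each round costs only one new colour.\<close>

lemma separate_bipartite_balls:
  assumes sym: "sym E" and m: "m > 0"
    and odd: "\<And>v L. odd L \<Longrightarrow> L \<le> 4 * q + 1 \<Longrightarrow> (v, v) \<notin> E ^^ L"
  shows "finite U \<Longrightarrow> real (card U) < (1 + 1 / real m) ^ q \<Longrightarrow>
    \<exists>P Z D. U = P \<union> Z \<union> D \<and> Z \<inter> D = {} \<and> stable_set E P \<and> stable_set E Z \<and> (\<forall>x\<in>Z. \<forall>y\<in>D. (x, y) \<notin> E)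
      \<and> m * card D \<le> card U"
proof (induction "card U" arbitrary: U rule: less_induct)
  case less
  show ?case
  proof (cases "U = {}")
    case True
    then show ?thesis by (auto simp: stable_set_def)
  next
    case False
    then obtain v where v: "v \<in> U" by blast
    define F where "F = E \<inter> U \<times> U"
    have FU: "F \<subseteq> U \<times> U" and FE: "F \<subseteq> E" unfolding F_def by auto
    have symF: "sym F" using sym unfolding F_def sym_def by auto
    let ?B = "walk_ball F v"
    obtain i where i: "i \<le> 2 * q" "m * card (?B (i + 2) - ?B i) \<le> card (?B i)"
      using slow_growth_index[OF less.prems(1) v FU less.prems(2) m] by blast
    have BU: "?B j \<subseteq> U" for j using walk_ball_subset[OF v FU] .
    have finB: "finite (?B j)" for j using BU less.prems(1) finite_subset by blast
    define U' where "U' = U - ?B (Suc i)"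
    have "v \<in> ?B (Suc i)" unfolding walk_ball_def by (auto intro!: exI[of _ 0])
    then have "U' \<subset> U" using v unfolding U'_def by blast
    then have cU': "card U' < card U" using less.prems(1) psubset_card_mono by blast
    moreover have "finite U'" using less.prems(1) U'_def by simp
    moreover have "real (card U') < (1 + 1 / real m) ^ q"
      using cU' less.prems(2) by linarith
    ultimately obtain P Z D where IH: "U' = P \<union> Z \<union> D" "Z \<inter> D = {}" "stable_set E P" "stable_set E Z"
      "\<forall>x\<in>Z. \<forall>y\<in>D. (x, y) \<notin> E" "m * card D \<le> card U'"
      using less.hyps[of U'] by blast
    \<comment> \<open>An edge would close an odd walk through \<open>v\<close> of length
      \<open>a + b + 1\<close>, which is at most \<open>2 * i + 1\<close> and hence at most
      \<open>4 * q + 1\<close>.\<close>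
    have par: "(x, y) \<notin> E" if "(v, x) \<in> F ^^ a" "(v, y) \<in> F ^^ b" "a \<le> i" "b \<le> i" "even (a + b)"
      for x y a b
    proof
      assume "(x, y) \<in> E"
      have xy: "(v, x) \<in> E ^^ a" "(v, y) \<in> E ^^ b"
        using that relpow_subset_mono[OF FE] by blast+
      have "(y, v) \<in> E ^^ b"
        using sym_relpow[OF sym xy(2)] .
      moreover have "(v, y) \<in> E ^^ (Suc a)" using xy(1) \<open>(x, y) \<in> E\<close> by auto
      ultimately have "(v, v) \<in> E ^^ (Suc a + b)"
        unfolding relpow_add by blast
      moreover have "odd (Suc a + b)" "Suc a + b \<le> 4 * q + 1" using that i by auto
      ultimately show False using odd by blast
    qed
    have inF: "(x, y) \<in> F" if "x \<in> U" "y \<in> U" "(x, y) \<in> E" for x y using that F_def by auto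
    define lay where "lay x = (LEAST j. (v, x) \<in> F ^^ j)" for x
    have lay: "(v, x) \<in> F ^^ lay x" "lay x \<le> j" if "x \<in> ?B j" for x j
      using that unfolding walk_ball_def lay_def
      by (auto intro: LeastI Least_le order_trans)
    have lay2: "x \<in> ?B (lay x)" if "x \<in> ?B j" for x j
      using lay[OF that] unfolding walk_ball_def by blast
    \<comment> \<open>Layers alternate between two classes, and the outermost layer \<open>i\<close>
      goes to \<open>PB\<close>. So vertices of \<open>ZB\<close> have distance less than
      \<open>i\<close> from \<open>v\<close>, and their neighbours in \<open>U\<close> stay inside
      the ball of radius \<open>i\<close>.\<close>
    define PB where "PB = {x \<in> ?B i. even (lay x + i)}"
    define ZB where "ZB = {x \<in> ?B i. odd (lay x + i)}"
    have par': "(x, y) \<notin> E" if "x \<in> ?B i" "y \<in> ?B i" "even (lay x + lay y)" for x y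
      using par[OF lay(1)[OF that(1)] lay(1)[OF that(2)] lay(2)[OF that(1)] lay(2)[OF that(2)] that(3)] .
    have PB_s: "stable_set E PB"
      unfolding stable_set_def PB_def using par' by simp
    have ZB_s: "stable_set E ZB"
      unfolding stable_set_def ZB_def using par' by simp
    have ZB_i: "y \<in> ?B i" if "x \<in> ZB" "y \<in> U" "(x, y) \<in> E" for x y
    proof -
      have x: "x \<in> ?B i" "odd (lay x + i)" using that ZB_def by auto
      have "lay x \<noteq> i" using x(2) by auto
      then have "Suc (lay x) \<le> i" using lay(2)[OF x(1)] by simp
      moreover have "y \<in> ?B (Suc (lay x))"
        using walk_ball_step[OF lay2[OF x(1)] inF[OF subsetD[OF BU x(1)] that(2,3)]] .
      ultimately show ?thesis using walk_ball_mono[of "Suc (lay x)" i F v] by blast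
    qed
    have BB: "?B i \<subseteq> ?B (Suc i)" "?B (Suc i) \<subseteq> ?B (i + 2)" by (auto intro!: walk_ball_mono)
    have step: "y \<in> ?B (Suc i)" if "x \<in> ?B i" "y \<in> U" "(x, y) \<in> E" for x y
      using walk_ball_step[OF that(1) inF[OF subsetD[OF BU that(1)] that(2,3)]] .
    have step2: "y \<in> ?B (i + 2)" if "x \<in> ?B (Suc i)" "y \<in> U" "(x, y) \<in> E" for x y
      using walk_ball_step[OF that(1) inF[OF subsetD[OF BU that(1)] that(2,3)]] by simp
    have sE: "(y, x) \<in> E" if "(x, y) \<in> E" for x y using that sym by (auto dest: symD)
    define L where "L = ?B (i + 2)"
    \<comment> \<open>Layer \<open>i + 1\<close> is discarded to cut the ball off from the rest. The
      vertices of the old \<open>Z\<close> in layer \<open>i + 2\<close> must follow, since they may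
      have neighbours in layer \<open>i + 1\<close>.\<close>
    define D2 where "D2 = (?B (Suc i) - ?B i) \<union> (D \<union> (Z \<inter> L))"
    have U'U: "P \<union> Z \<union> D \<subseteq> U" "(P \<union> Z \<union> D) \<inter> ?B (Suc i) = {}" using IH(1) U'_def by auto
    have "U = (PB \<union> P) \<union> (ZB \<union> (Z - L)) \<union> D2"
    proof -
      have "U = ?B (Suc i) \<union> U'" using U'_def BU by blast
      moreover have "PB \<union> ZB = ?B i" unfolding PB_def ZB_def by blast
      ultimately show ?thesis using BB IH(1) unfolding D2_def by blast
    qed
    moreover have "(ZB \<union> (Z - L)) \<inter> D2 = {}"
      using U'U BB IH(2) unfolding D2_def ZB_def by blast
    moreover have "stable_set E (PB \<union> P)"
    proof -
      have "(x, y) \<notin> E" if "x \<in> PB" "y \<in> P" for x y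
        using step[of x y] that U'U unfolding PB_def by blast
      then show ?thesis using PB_s IH(3) sE unfolding stable_set_def by blast
    qed
    moreover have "stable_set E (ZB \<union> (Z - L))"
    proof -
      have "(x, y) \<notin> E" if "x \<in> ZB" "y \<in> Z" for x y
        using step[of x y] that U'U unfolding ZB_def by blast
      then show ?thesis using ZB_s IH(4) sE unfolding stable_set_def by blast
    qed
    moreover have "\<forall>x \<in> ZB \<union> (Z - L). \<forall>y \<in> D2. (x, y) \<notin> E"
    proof (intro ballI notI)
      fix x y assume x: "x \<in> ZB \<union> (Z - L)" and y: "y \<in> D2" and xy: "(x, y) \<in> E"
      have yU: "y \<in> U" using y BU U'U unfolding D2_def by blast
      show False
      proof (cases "x \<in> ZB")
        case True
        then have "y \<in> ?B i" using ZB_i yU xy by blast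
        then show ?thesis using y BB U'U unfolding D2_def by blast
      next
        case False
        then have x': "x \<in> Z" "x \<notin> L" using x by auto
        then have xU: "x \<in> U" using U'U by blast
        have "y \<notin> ?B (Suc i)" using step2[OF _ xU sE[OF xy]] x' L_def by blast
        then have "y \<in> D \<union> (Z \<inter> L)" using y unfolding D2_def by blast
        then show ?thesis using IH(4,5) x' xy unfolding stable_set_def by blast
      qed
    qed
    \<comment> \<open>The two discarded layers are charged to the ball of radius \<open>i\<close>
      and the old \<open>D\<close> to \<open>U'\<close>; these are disjoint subsets of
      \<open>U\<close>.\<close>
    moreover have "m * card D2 \<le> card U"
    proof -
      have "D2 \<subseteq> (?B (i + 2) - ?B i) \<union> D"
        using BB U'U unfolding D2_def L_def by blast
      moreover have "finite ((?B (i + 2) - ?B i) \<union> D)"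
        using finB \<open>finite U'\<close> IH(1) by auto
      ultimately have "card D2 \<le> card (?B (i + 2) - ?B i) + card D"
        by (meson card_Un_le card_mono order_trans)
      then have "m * card D2 \<le> m * card (?B (i + 2) - ?B i) + m * card D"
        by (metis distrib_left mult_le_mono2)
      also have "\<dots> \<le> card (?B i) + card U'" using i(2) IH(6) by simp
      also have "\<dots> = card (?B i \<union> U')"
        using finB \<open>finite U'\<close> BB unfolding U'_def by (intro card_Un_disjoint[symmetric]) auto
      also have "\<dots> \<le> card U"
        using less.prems(1) BU unfolding U'_def by (intro card_mono) auto
      finally show ?thesis .
    qed
    ultimately show ?thesis by blast
  qed
qed

text \<open>Each round divides the size of the remaining set by \<open>m\<close> at the price of the
  one colour given to \<open>P\<close>, so \<open>r\<close> rounds leave nothing. The extra colour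
  ensures that \<open>Z\<close> can get colour 0 even if \<open>D\<close> is empty.\<close>

lemma colourable_if_no_short_odd_walk:
  assumes sym: "sym E" and m: "m > 0"
    and odd: "\<And>v L. odd L \<Longrightarrow> L \<le> 4 * q + 1 \<Longrightarrow> (v, v) \<notin> E ^^ L"
  shows "finite U \<Longrightarrow> real (card U) < (1 + 1 / real m) ^ q \<Longrightarrow> card U < m ^ r \<Longrightarrow>
    colourable E U (Suc r)"
proof (induction r arbitrary: U)
  case 0
  then show ?case by (auto simp: colourable_def)
next
  case (Suc r)
  obtain P Z D where PZD: "U = P \<union> Z \<union> D" "Z \<inter> D = {}" "stable_set E P" "stable_set E Z"
    "\<forall>x\<in>Z. \<forall>y\<in>D. (x, y) \<notin> E" "m * card D \<le> card U"
    using separate_bipartite_balls[OF sym m odd Suc.prems(1,2)] by blast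
  have "m * card D < m * m ^ r" using PZD(6) Suc.prems(3) by (metis le_less_trans power_Suc)
  then have "card D < m ^ r" using nat_mult_less_cancel1[OF m] by blast
  moreover have "finite D" using PZD(1) Suc.prems(1) by simp
  moreover have "card D \<le> card U" using PZD(1) Suc.prems(1) by (intro card_mono) auto
  ultimately have "colourable E D (Suc r)" using Suc.IH[of D] Suc.prems(2) by simp
  then obtain c :: "'a \<Rightarrow> nat"
    where c: "\<forall>x\<in>D. c x < Suc r" "\<forall>x\<in>D. \<forall>y\<in>D. (x, y) \<in> E \<longrightarrow> c x \<noteq> c y"
    unfolding colourable_def by blast
  have "\<forall>x\<in>D. \<forall>y\<in>Z. (x, y) \<notin> E" using PZD(5) sym by (auto dest: symD)
  then have "colourable E (D \<union> Z) (Suc r)"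
    unfolding colourable_def
    by (intro exI[of _ "\<lambda>x. if x \<in> Z then 0 else c x"])
      (use c PZD in \<open>auto simp: stable_set_def\<close>)
  then have "colourable E (D \<union> Z \<union> P) (Suc (Suc r))"
    using PZD(3) by (rule colourable_Un_stable)
  moreover have "D \<union> Z \<union> P = U" using PZD(1) by blast
  ultimately show ?case by simp
qed

section \<open>Triangle-free graphs with a stable set of almost two thirds of the vertices\<close>

text \<open>Loops are excluded as well: a loop would be a triangle with
  \<open>x = y = z\<close>.\<close>

locale dense_triangle_free =
  fixes V :: "'a set" and E :: "('a \<times> 'a) set" and s :: real
  assumes finite_V: "finite V"
    and E_sub: "E \<subseteq> V \<times> V"
    and sym_E: "sym E"
    and no_triangle: "(x, y) \<in> E \<Longrightarrow> (y, z) \<in> E \<Longrightarrow> (x, z) \<notin> E"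
    and degree_ge: "x \<in> V \<Longrightarrow> real (card V) / 3 - s \<le> real (card (E `` {x}))"
    and s_pos: "s > 0"
begin

lemma edge_sym: "(x, y) \<in> E \<Longrightarrow> (y, x) \<in> E"
  using sym_E by (auto dest: symD)

lemma nbrs_sub: "E `` {x} \<subseteq> V"
  using E_sub by auto

lemma finite_nbrs [simp]: "finite (E `` {x})"
  using nbrs_sub finite_V finite_subset by blast

lemma nbrs_disjoint: "(x, y) \<in> E \<Longrightarrow> E `` {x} \<inter> E `` {y} = {}"
  using no_triangle edge_sym by fast

text \<open>Consecutive vertices of the walk have no common neighbour, so the cyclic shift
  \<open>g\<close> moves the index set off itself, and both copies fit into \<open>L\<close>
  places.\<close>

lemma count_closed_walk_nbrs:
  assumes closed: "f 0 = f L" and walk: "\<And>i. i < L \<Longrightarrow> (f i, f (Suc i)) \<in> E"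
  shows "2 * card {i. i < L \<and> (f i, y) \<in> E} \<le> L"
proof -
  let ?J = "{i. i < L \<and> (f i, y) \<in> E}"
  define g where "g i = (if Suc i = L then 0 else Suc i)" for i
  have fg: "f (g i) = f (Suc i)" for i using closed by (auto simp: g_def)
  have inj: "inj_on g ?J" by (auto simp: inj_on_def g_def split: if_splits)
  have "g ` ?J \<inter> ?J = {}"
  proof -
    have False if "i \<in> ?J" "g i \<in> ?J" for i
      using that walk[of i] no_triangle[of "f i" "f (Suc i)" y] fg[of i] by auto
    then show ?thesis by blast
  qed
  then have "card (g ` ?J) + card ?J = card (g ` ?J \<union> ?J)"
    by (intro card_Un_disjoint[symmetric]) auto
  also have "\<dots> \<le> card {..<L}" by (intro card_mono) (auto simp: g_def)
  finally show ?thesis using card_image[OF inj] by simp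
qed

end

text \<open>Two positions adjacent to \<open>y\<close> split the walk into an odd and an even piece.
  The odd piece closed up through \<open>y\<close> has length at least \<open>L\<close> by
  minimality, so the even piece has length exactly 2. Counted from the first such position
  \<open>a\<close>, only \<open>a + 2\<close> and \<open>a + (L - 2)\<close> remain.\<close>

lemma count_shortest_odd_walk_nbrs:
  fixes F :: "('a \<times> 'a) set"
  assumes sym: "sym F" and closed: "f 0 = f L"
    and walk: "\<And>i. i < L \<Longrightarrow> (f i, f (Suc i)) \<in> F" and L: "odd L"
    and min: "\<And>v M. odd M \<Longrightarrow> (v, v) \<in> F ^^ M \<Longrightarrow> L \<le> M"
  shows "card {i. i < L \<and> (f i, y) \<in> F} \<le> 3"
proof (cases "{i. i < L \<and> (f i, y) \<in> F} = {}")
  case True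
  then show ?thesis by (simp only: card.empty)
next
  case False
  let ?J = "{i. i < L \<and> (f i, y) \<in> F}"
  define a where "a = Min ?J"
  have a: "a \<in> ?J" "\<And>i. i \<in> ?J \<Longrightarrow> a \<le> i"
    using False Min_in[of ?J] by (auto simp: a_def)
  have sub: "(f i, f j) \<in> F ^^ (j - i)" if "i \<le> j" "j \<le> L" for i j
    unfolding relpow_fun_conv
    by (rule exI[of _ "\<lambda>k. f (i + k)"]) (use that walk in auto)
  have "i \<in> {a, a + 2, a + (L - 2)}" if i: "i \<in> ?J" for i
  proof (cases "i = a")
    case False
    then have ai: "a < i" "i < L" using a(2)[OF i] i by auto
    have ya: "(y, f a) \<in> F" "(y, f i) \<in> F" "(f a, y) \<in> F" "(f i, y) \<in> F"
      using a(1) i sym by (auto dest: symD)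
    have "(y, f i) \<in> F ^^ Suc (i - a)"
      using relpow_Suc_I2[OF ya(1) sub[of a i]] ai by simp
    then have w1: "(y, y) \<in> F ^^ Suc (Suc (i - a))"
      using ya(4) by (rule relpow_Suc_I)
    have "(f i, f L) \<in> F ^^ (L - i)" "(f 0, f a) \<in> F ^^ (a - 0)"
      using sub[of i L] sub[of 0 a] ai by auto
    then have "(f i, f a) \<in> F ^^ ((L - i) + a)"
      using closed unfolding relpow_add by auto
    then have "(y, f a) \<in> F ^^ Suc ((L - i) + a)"
      by (rule relpow_Suc_I2[OF ya(2)])
    then have w2: "(y, y) \<in> F ^^ Suc (Suc ((L - i) + a))"
      using ya(3) by (rule relpow_Suc_I)
    show ?thesis
    proof (cases "even (i - a)")
      case True
      then have "odd (Suc (Suc ((L - i) + a)))" using L ai by auto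
      then have "L \<le> Suc (Suc ((L - i) + a))" using min w2 by blast
      then have "i - a \<le> 2" using ai by linarith
      moreover have "i - a \<noteq> 1" using True by (metis odd_one)
      moreover have "i - a \<noteq> 0" using ai by simp
      ultimately have "i - a = 2" by linarith
      then show ?thesis using ai by auto
    next
      case odd: False
      then have "L \<le> Suc (Suc (i - a))" using min[of "Suc (Suc (i - a))" y] w1 by simp
      moreover have "i - a \<noteq> L - 1" using odd L by (metis odd_even_add even_diff_nat odd_one)
      moreover have "i - a \<le> L - 1" using ai by linarith
      ultimately have "i - a = L - 2" by linarith
      then show ?thesis using ai by auto
    qed
  qed simp
  then have "?J \<subseteq> {a, a + 2, a + (L - 2)}" by blast
  then have "card ?J \<le> card {a, a + 2, a + (L - 2)}" by (intro card_mono) auto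
  also have "\<dots> \<le> 3" by (simp add: card_insert_if)
  finally show ?thesis .
qed

context dense_triangle_free
begin

text \<open>The last bound says that \<open>B\<close> falls short of two thirds in proportion to
  \<open>H\<close>. It comes from counting the edges that leave \<open>B\<close>: a vertex of
  \<open>H\<close> receives at most \<open>n / 3 + 2 * s\<close> of them, noticeably fewer than
  \<open>card B\<close>.\<close>

lemma large_stable_set_decomposition:
  assumes B0: "B0 \<subseteq> V" "stable_set E B0" "real (card B0) \<ge> (2 / 3 - 1 / 16) * real (card V)"
    and small: "500 * s < real (card V)"
  obtains A B H where "V = A \<union> B \<union> H" "A \<inter> B = {}" "A \<inter> H = {}" "B \<inter> H = {}"
    "stable_set E A" "stable_set E B" "\<And>x y. x \<in> A \<Longrightarrow> y \<in> H \<Longrightarrow> (x, y) \<notin> E"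
    "real (card B) \<ge> (2 / 3 - 1 / 16) * real (card V)"
    "real (card B) \<le> 2 * real (card V) / 3 + s - 11 / 25 * real (card H)"
proof -
  define n where "n = real (card V)"
  have "finite {B. B \<subseteq> V \<and> stable_set E B}" using finite_V by simp
  then obtain B where B: "B \<subseteq> V" "stable_set E B" "B0 \<subseteq> B"
    and max: "\<And>B'. B' \<subseteq> V \<Longrightarrow> stable_set E B' \<Longrightarrow> B \<subseteq> B' \<Longrightarrow> B = B'"
    using finite_has_maximal2[of "{B. B \<subseteq> V \<and> stable_set E B}" B0] B0 by auto
  define b where "b = real (card B)"
  have finB: "finite B" using B(1) finite_V finite_subset by blast
  have n_pos: "n > 0" using small s_pos n_def by linarith
  have small': "500 * s < n" using small n_def by simp
  have b_ge: "b \<ge> (2 / 3 - 1 / 16) * n"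
    using B0(3) card_mono[OF finB B(3)] unfolding n_def b_def by linarith
  then have b_ge': "b \<ge> 29 / 48 * n" by simp
  have cVB: "real (card (V - B)) = n - b"
    using card_Diff_subset[OF finB B(1)] card_mono[OF finite_V B(1)]
    unfolding n_def b_def by simp
  have nbB: "E `` {y} \<subseteq> V - B" if "y \<in> B" for y
    using that B(2) nbrs_sub unfolding stable_set_def by blast
  have b_pos: "b > 0" using b_ge n_pos by (simp add: field_simps)
  then obtain y0 where y0: "y0 \<in> B" unfolding b_def by fastforce
  have b_le: "b \<le> 2 * n / 3 + s"
  proof -
    have "n / 3 - s \<le> real (card (E `` {y0}))" using degree_ge y0 B(1) n_def by auto
    also have "\<dots> \<le> n - b"
      using card_mono[OF _ nbB[OF y0]] finite_V cVB by (metis finite_Diff of_nat_le_iff)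
    finally show ?thesis by linarith
  qed
  define bd where "bd x = real (card (E `` {x} \<inter> B))" for x
  \<comment> \<open>By maximality \<open>x\<close> has a neighbour \<open>y\<close> in
    \<open>B\<close>. The neighbours of \<open>y\<close> lie outside \<open>B\<close> and none of
    them is a neighbour of \<open>x\<close>, so \<open>x\<close> has at most
    \<open>n - b - (n / 3 - s)\<close> neighbours outside \<open>B\<close>.\<close>
  have bd_ge: "bd x \<ge> b - n / 3 - 2 * s" if x: "x \<in> V - B" for x
  proof -
    have "\<not> stable_set E (insert x B)"
      using max[of "insert x B"] x B(1) by blast
    then obtain y where y: "y \<in> B" "(x, y) \<in> E"
      using B(2) no_triangle edge_sym unfolding stable_set_def by blast
    have disj: "E `` {x} \<inter> E `` {y} = {}" using nbrs_disjoint y by blast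
    have "card ((E `` {x} - B) \<union> E `` {y}) \<le> card (V - B)"
      using nbB[OF y(1)] nbrs_sub finite_V by (intro card_mono) auto
    moreover have "card ((E `` {x} - B) \<union> E `` {y}) = card (E `` {x} - B) + card (E `` {y})"
      using disj by (intro card_Un_disjoint) auto
    ultimately have "real (card (E `` {x} - B)) + real (card (E `` {y})) \<le> n - b"
      using cVB by linarith
    moreover have "n / 3 - s \<le> real (card (E `` {y}))" using degree_ge y B(1) n_def by auto
    moreover have "n / 3 - s \<le> real (card (E `` {x}))" using degree_ge x n_def by auto
    moreover have "card (E `` {x}) = card (E `` {x} \<inter> B) + card (E `` {x} - B)"
      by (rule card_Int_Diff) simp
    ultimately show ?thesis unfolding bd_def by linarith
  qed
  \<comment> \<open>Twice the threshold exceeds the bound \<open>b_le\<close>, so no two vertices of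
    \<open>A\<close> are adjacent; added to the bound \<open>bd_ge\<close> it gives exactly
    \<open>b\<close>, so \<open>A\<close> and \<open>H\<close> are not joined either.\<close>
  define A where "A = {x \<in> V - B. bd x > n / 3 + 2 * s}"
  define H where "H = V - B - A"
  have AH: "V = A \<union> B \<union> H" "A \<inter> B = {}" "A \<inter> H = {}" "B \<inter> H = {}"
    using B(1) unfolding A_def H_def by auto
  have fin: "finite A" "finite H" using AH(1) finite_V by (metis finite_Un)+
  have no_edge: "(x, y) \<notin> E" if "bd x + bd y > b" for x y
  proof
    assume "(x, y) \<in> E"
    then have "E `` {x} \<inter> E `` {y} = {}" by (rule nbrs_disjoint)
    then have "card (E `` {x} \<inter> B \<union> E `` {y} \<inter> B) = card (E `` {x} \<inter> B) + card (E `` {y} \<inter> B)"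
      by (intro card_Un_disjoint) auto
    moreover have "card (E `` {x} \<inter> B \<union> E `` {y} \<inter> B) \<le> card B"
      using finB by (intro card_mono) auto
    ultimately show False using that unfolding bd_def b_def by linarith
  qed
  have sA: "stable_set E A"
    unfolding stable_set_def
  proof (intro ballI)
    fix x y assume "x \<in> A" "y \<in> A"
    then have "bd x > n / 3 + 2 * s" "bd y > n / 3 + 2 * s" by (auto simp: A_def)
    then show "(x, y) \<notin> E" using b_le s_pos by (intro no_edge) linarith
  qed
  have sAH: "(x, y) \<notin> E" if "x \<in> A" "y \<in> H" for x y
  proof -
    have "bd x > n / 3 + 2 * s" using that by (auto simp: A_def)
    moreover have "bd y \<ge> b - n / 3 - 2 * s" using that bd_ge by (auto simp: H_def)
    ultimately show ?thesis by (intro no_edge) linarith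
  qed
  have cnt: "real (card (E `` {y} \<inter> S)) = (\<Sum>x\<in>S. of_bool ((y, x) \<in> E))" if "finite S" for y S
  proof -
    have "{x \<in> S. (y, x) \<in> E} = E `` {y} \<inter> S" by auto
    then show ?thesis using that by (simp add: sum.If_cases of_bool_def Int_def)
  qed
  have "b * (n / 3 - s) \<le> (\<Sum>y\<in>B. real (card (E `` {y})))"
    using sum_mono[of B "\<lambda>_. n / 3 - s" "\<lambda>y. real (card (E `` {y}))"] degree_ge B(1)
    unfolding n_def b_def by auto
  also have "\<dots> = (\<Sum>y\<in>B. \<Sum>x\<in>A \<union> H. of_bool ((y, x) \<in> E))"
  proof (rule sum.cong)
    fix y assume "y \<in> B"
    then have "E `` {y} = E `` {y} \<inter> (A \<union> H)" using nbB[of y] AH(1) by blast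
    then show "real (card (E `` {y})) = (\<Sum>x\<in>A \<union> H. of_bool ((y, x) \<in> E))"
      using cnt[of "A \<union> H" y] fin by simp
  qed simp
  also have "\<dots> = (\<Sum>x\<in>A \<union> H. \<Sum>y\<in>B. of_bool ((x, y) \<in> E))"
  proof (subst sum.swap, intro sum.cong refl)
    fix x y show "(of_bool ((y, x) \<in> E) :: real) = of_bool ((x, y) \<in> E)"
      using edge_sym by auto
  qed
  also have "\<dots> = (\<Sum>x\<in>A \<union> H. bd x)"
    using cnt[OF finB] unfolding bd_def by simp
  also have "\<dots> = (\<Sum>x\<in>A. bd x) + (\<Sum>x\<in>H. bd x)"
    using fin AH(3) by (intro sum.union_disjoint) auto
  also have "\<dots> \<le> (\<Sum>x\<in>A. b) + (\<Sum>x\<in>H. n / 3 + 2 * s)"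
    using finB by (intro add_mono sum_mono)
      (auto simp: bd_def b_def A_def H_def not_less intro!: card_mono)
  finally have count: "b * (n / 3 - s) \<le> real (card A) * b + real (card H) * (n / 3 + 2 * s)"
    by simp
  define h where "h = real (card H)"
  have "card V = card A + card B + card H"
    using AH fin finB by (simp add: card_Un_disjoint Int_Un_distrib2)
  then have a: "real (card A) = n - b - h" unfolding n_def b_def h_def by simp
  have "b * (n / 3 - s) \<le> b * (n - b) - h * (b - n / 3 - 2 * s)"
    using count unfolding a h_def[symmetric] by (simp add: algebra_simps)
  \<comment> \<open>The factor \<open>11 / 25\<close> fits because \<open>14 / 25 * b\<close>
    exceeds \<open>n / 3 + 2 * s\<close>, given that \<open>b\<close> is at least
    \<open>29 / 48 * n\<close> and \<open>s\<close> is below \<open>n / 500\<close>.\<close>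
  moreover have "h * (11 / 25 * b) \<le> h * (b - n / 3 - 2 * s)"
  proof (rule mult_left_mono)
    show "11 / 25 * b \<le> b - n / 3 - 2 * s" using b_ge' small' n_pos by linarith
  qed (simp add: h_def)
  ultimately have "b * (n / 3 - s) \<le> b * (n - b - 11 / 25 * h)"
    by (simp add: algebra_simps)
  then have "n / 3 - s \<le> n - b - 11 / 25 * h" using b_pos by (simp only: mult_le_cancel_left_pos)
  then have "b \<le> 2 * n / 3 + s - 11 / 25 * h" by linarith
  then show ?thesis
    using that[OF AH sA B(2) sAH] b_ge unfolding b_def n_def h_def by blast
qed

lemma of_bool_nbrs:
  assumes "finite S" "E `` {x} \<subseteq> S"
  shows "card (E `` {x}) = (\<Sum>y\<in>S. of_bool ((x, y) \<in> E))"
proof -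
  have "S \<inter> {y. (x, y) \<in> E} = E `` {x}" using assms(2) by auto
  then show ?thesis using assms(1) by (simp add: sum.If_cases of_bool_def)
qed

text \<open>Degrees are summed along a shortest odd closed walk in \<open>H\<close>, of length
  \<open>K = 2 * l + 1\<close>. Its neighbours avoid \<open>A\<close>; each vertex of
  \<open>B\<close> is met at most \<open>l\<close> times and each vertex of \<open>H\<close> at most
  three times. The bound on \<open>card B\<close> then forces \<open>K\<close> to be of order at
  least \<open>n / s\<close>.\<close>

lemma no_short_odd_walk:
  assumes V: "V = A \<union> B \<union> H" "B \<inter> H = {}" "A \<inter> H = {}"
    and AH: "\<And>x y. x \<in> A \<Longrightarrow> y \<in> H \<Longrightarrow> (x, y) \<notin> E"
    and b_ge: "real (card B) \<ge> (2 / 3 - 1 / 16) * real (card V)"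
    and b_le: "real (card B) \<le> 2 * real (card V) / 3 + s - 11 / 25 * real (card H)"
    and L: "odd L" "100 * real L * s < real (card V)"
  shows "(v, v) \<notin> (E \<inter> H \<times> H) ^^ L"
proof
  assume "(v, v) \<in> (E \<inter> H \<times> H) ^^ L"
  define F where "F = E \<inter> H \<times> H"
  have symF: "sym F" using edge_sym unfolding F_def sym_def by auto
  have fin: "finite B" "finite H" using V(1) finite_V by (metis finite_Un)+
  define Q where "Q M \<longleftrightarrow> odd M \<and> (\<exists>v. (v, v) \<in> F ^^ M)" for M
  define K where "K = (LEAST M. Q M)"
  have QL: "Q L" using \<open>(v, v) \<in> _\<close> L(1) unfolding Q_def F_def by blast
  then have QK: "Q K" and "K \<le> L" unfolding K_def by (auto intro: LeastI Least_le)
  have min: "K \<le> M" if "odd M" "(v, v) \<in> F ^^ M" for v M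
    using that unfolding K_def Q_def by (blast intro: Least_le)
  have oddK: "odd K" using QK Q_def by blast
  obtain w where "(w, w) \<in> F ^^ K" using QK Q_def by blast
  then obtain f where f: "f 0 = f K" "\<And>i. i < K \<Longrightarrow> (f i, f (Suc i)) \<in> F"
    unfolding relpow_fun_conv by metis
  have fE: "(f i, f (Suc i)) \<in> E" "f i \<in> H" "f (Suc i) \<in> H" if "i < K" for i
    using f(2)[OF that] F_def by auto
  have "K \<noteq> 1" using fE(1)[of 0] f(1) no_triangle by auto
  \<comment> \<open>Excluding length 3 gives \<open>l \<ge> 2\<close>; with \<open>l = 1\<close> the
    coefficient of \<open>card H\<close> would be too large for the final estimate.\<close>
  moreover have "K \<noteq> 3"
  proof
    assume "K = 3"
    then have "(f 0, f 1) \<in> E" "(f 1, f 2) \<in> E" "(f 2, f 0) \<in> E"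
      using fE(1)[of 0] fE(1)[of 1] fE(1)[of 2] f(1) by (auto simp: numeral_eq_Suc)
    then show False using no_triangle edge_sym by blast
  qed
  ultimately have K5: "K \<ge> 5" using oddK by presburger
  obtain l where l: "K = 2 * l + 1" using oddK by (rule oddE)
  have l2: "l \<ge> 2" using K5 l by simp
  have "real K * (real (card V) / 3 - s) = (\<Sum>i<K. real (card V) / 3 - s)" by simp
  also have "\<dots> \<le> (\<Sum>i<K. real (card (E `` {f i})))"
    using fE(2) V(1) by (intro sum_mono degree_ge) auto
  also have "\<dots> = real (\<Sum>i<K. card (E `` {f i}))" by simp
  also have "(\<Sum>i<K. card (E `` {f i})) = (\<Sum>i<K. \<Sum>y\<in>B \<union> H. of_bool ((f i, y) \<in> E))"
  proof (intro sum.cong refl of_bool_nbrs)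
    fix i assume "i \<in> {..<K}"
    then show "E `` {f i} \<subseteq> B \<union> H"
      using AH edge_sym nbrs_sub[of "f i"] fE(2)[of i] V(1) by blast
  qed (use fin in auto)
  also have "\<dots> = (\<Sum>y\<in>B \<union> H. card {i. i < K \<and> (f i, y) \<in> E})"
    by (subst sum.swap, intro sum.cong refl)
      (simp add: of_bool_def sum.If_cases lessThan_def Int_def)
  also have "\<dots> = (\<Sum>y\<in>B. card {i. i < K \<and> (f i, y) \<in> E}) + (\<Sum>y\<in>H. card {i. i < K \<and> (f i, y) \<in> E})"
    using fin V(2) by (intro sum.union_disjoint) auto
  also have "\<dots> \<le> (\<Sum>y\<in>B. l) + (\<Sum>y\<in>H. 3)"
  proof (intro add_mono sum_mono)
    fix y show "card {i. i < K \<and> (f i, y) \<in> E} \<le> l"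
      using count_closed_walk_nbrs[of f K y] f(1) fE(1) l by simp
  next
    fix y assume y: "y \<in> H"
    have "{i. i < K \<and> (f i, y) \<in> E} = {i. i < K \<and> (f i, y) \<in> F}"
      using y fE(2) F_def by auto
    then show "card {i. i < K \<and> (f i, y) \<in> E} \<le> 3"
      using count_shortest_odd_walk_nbrs[OF symF f(1) f(2) oddK min] by simp
  qed
  finally have "real K * (real (card V) / 3 - s) \<le> real l * real (card B) + 3 * real (card H)"
    by (simp add: mult.commute)
  moreover have "real l * real (card B) \<le> real l * (2 * real (card V) / 3 + s - 11 / 25 * real (card H))"
    using b_le by (intro mult_left_mono) auto
  ultimately have *: "real (card V) / 3 \<le> (3 * real l + 1) * s + (3 - 11 / 25 * real l) * real (card H)"
    unfolding l by (simp add: algebra_simps)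
  have "(3 - 11 / 25 * real l) * real (card H) \<le> 53 / 25 * real (card H)"
    using l2 by (intro mult_right_mono) auto
  moreover have "11 / 25 * real (card H) \<le> (1 / 16) * real (card V) + s"
    using b_ge b_le by (simp add: algebra_simps)
  \<comment> \<open>Eliminating \<open>card H\<close> costs \<open>53 / 11\<close> times
    \<open>card V / 16 + s\<close>, and \<open>1 / 3 - 53 / 176\<close> is more than
    \<open>3 / 100\<close>.\<close>
  ultimately have "3 / 100 * real (card V) \<le> (3 * real l + 1) * s + 5 * s"
    using * s_pos by linarith
  also have "\<dots> = (3 * real l + 6) * s" by (simp add: algebra_simps)
  also have "\<dots> \<le> (3 * real K) * s" using l l2 s_pos by (intro mult_right_mono) auto
  also have "\<dots> \<le> (3 * real L) * s" using \<open>K \<le> L\<close> s_pos by (intro mult_right_mono) auto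
  finally show False using L(2) by (simp add: ac_simps)
qed

text \<open>\<open>H\<close> takes \<open>r + 1\<close> colours, \<open>A\<close> and
  \<open>B\<close> one each. The summand 5 in the bound on \<open>q\<close> covers walk lengths up
  to \<open>4 * q + 1\<close> and also yields \<open>500 * s < card V\<close> for the
  decomposition.\<close>

lemma colourable_if_large_stable_set:
  assumes B0: "B0 \<subseteq> V" "stable_set E B0" "real (card B0) \<ge> (2 / 3 - 1 / 16) * real (card V)"
    and m: "m > 0" "card V < m ^ r" "real (card V) < (1 + 1 / real m) ^ q"
    and q: "100 * (4 * real q + 5) * s < real (card V)"
  shows "colourable E V (r + 3)"
proof -
  have "100 * 5 * s \<le> 100 * (4 * real q + 5) * s" using s_pos by (intro mult_right_mono) auto
  then have "500 * s < real (card V)" using q by linarith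
  from large_stable_set_decomposition[OF B0 this] obtain A B H
    where ABH: "V = A \<union> B \<union> H" "A \<inter> B = {}" "A \<inter> H = {}" "B \<inter> H = {}"
    "stable_set E A" "stable_set E B" "\<And>x y. x \<in> A \<Longrightarrow> y \<in> H \<Longrightarrow> (x, y) \<notin> E"
    "real (card B) \<ge> (2 / 3 - 1 / 16) * real (card V)"
    "real (card B) \<le> 2 * real (card V) / 3 + s - 11 / 25 * real (card H)"
    by metis
  have finH: "finite H" using ABH(1) finite_V by (metis finite_Un)
  have cH: "card H \<le> card V" using ABH(1) finite_V by (intro card_mono) auto
  have "colourable (E \<inter> H \<times> H) H (Suc r)"
  proof (rule colourable_if_no_short_odd_walk[where m = m and q = q])
    show "sym (E \<inter> H \<times> H)" using edge_sym unfolding sym_def by auto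
    fix v L assume L: "odd L" "L \<le> 4 * q + 1"
    have "100 * real L * s \<le> 100 * (4 * real q + 5) * s"
      using L s_pos by (intro mult_right_mono) auto
    then have "100 * real L * s < real (card V)" using q by linarith
    then show "(v, v) \<notin> (E \<inter> H \<times> H) ^^ L"
      using no_short_odd_walk[OF ABH(1,4,3,7,8,9) L(1)] by blast
  qed (use m finH cH in auto)
  then have "colourable E H (Suc r)"
    unfolding colourable_def by (elim exE, intro exI) auto
  then have "colourable E (H \<union> A \<union> B) (Suc (Suc (Suc r)))"
    using ABH(5,6) by (intro colourable_Un_stable)
  moreover have "H \<union> A \<union> B = V" using ABH(1) by blast
  ultimately show ?thesis by (simp add: numeral_eq_Suc)
qed

end

section \<open>Approximation by finitely many coordinates\<close>

definition ip :: "'a set \<Rightarrow> ('a \<Rightarrow> real) \<Rightarrow> ('a \<Rightarrow> real) \<Rightarrow> real" where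
  "ip V f g = (\<Sum>x\<in>V. f x * g x)"

definition orthonormal_on :: "'a set \<Rightarrow> nat \<Rightarrow> (nat \<Rightarrow> 'a \<Rightarrow> real) \<Rightarrow> bool" where
  "orthonormal_on V q e \<longleftrightarrow> (\<forall>i<q. \<forall>j<q. ip V (e i) (e j) = of_bool (i = j))"

text \<open>For an orthonormal family this is the component of \<open>w\<close> orthogonal to its
  first \<open>q\<close> members.\<close>

definition residual :: "'a set \<Rightarrow> nat \<Rightarrow> (nat \<Rightarrow> 'a \<Rightarrow> real) \<Rightarrow> ('a \<Rightarrow> real) \<Rightarrow> 'a \<Rightarrow> real" where
  "residual V q e w y = w y - (\<Sum>i<q. ip V w (e i) * e i y)"

lemma ip_commute: "ip V f g = ip V g f"
  unfolding ip_def by (simp add: mult.commute)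

lemma ip_self_nonneg: "ip V f f \<ge> 0"
  unfolding ip_def by (simp add: sum_nonneg)

lemma ip_diff_left: "ip V (\<lambda>y. f y - g y) h = ip V f h - ip V g h"
  unfolding ip_def by (simp add: algebra_simps sum_subtractf)

lemma ip_sum_left: "ip V (\<lambda>y. \<Sum>i\<in>I. a i * f i y) h = (\<Sum>i\<in>I. a i * ip V (f i) h)"
  unfolding ip_def sum_distrib_right sum_distrib_left
  by (subst sum.swap) (simp add: mult.assoc)

text \<open>Lagrange's identity: the double sum of the squares of
  \<open>f x * g y - f y * g x\<close> is twice the difference of the two sides.\<close>

lemma Cauchy_Schwarz_ip: "(ip V f g)\<^sup>2 \<le> ip V f f * ip V g g"
proof -
  have "0 \<le> (\<Sum>x\<in>V. \<Sum>y\<in>V. (f x * g y - f y * g x)\<^sup>2)" by (intro sum_nonneg) auto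
  also have "\<dots> = (\<Sum>x\<in>V. \<Sum>y\<in>V. (f x * f x) * (g y * g y) + (g x * g x) * (f y * f y)
      - 2 * ((f x * g x) * (f y * g y)))"
    by (simp add: power2_eq_square algebra_simps)
  also have "\<dots> = ip V f f * ip V g g + ip V g g * ip V f f - 2 * (ip V f g * ip V f g)"
    unfolding ip_def
    by (simp only: sum.distrib sum_subtractf sum_distrib_left[symmetric] sum_distrib_right[symmetric])
  finally show ?thesis by (simp add: power2_eq_square)
qed

lemma ip_residual:
  assumes "orthonormal_on V q e" "j < q"
  shows "ip V (residual V q e w) (e j) = 0"
proof -
  have "ip V (residual V q e w) (e j) = ip V w (e j) - (\<Sum>i<q. ip V w (e i) * ip V (e i) (e j))"
    unfolding residual_def by (simp add: ip_diff_left ip_sum_left)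
  also have "(\<Sum>i<q. ip V w (e i) * ip V (e i) (e j)) = (\<Sum>i<q. if i = j then ip V w (e i) else 0)"
    using assms unfolding orthonormal_on_def by (intro sum.cong) auto
  finally show ?thesis using assms(2) by simp
qed

text \<open>Pythagoras for the splitting of \<open>w\<close> into its projection and its
  residual.\<close>

lemma ip_self_residual:
  assumes "orthonormal_on V q e"
  shows "ip V w w = ip V (residual V q e w) (residual V q e w) + (\<Sum>i<q. (ip V w (e i))\<^sup>2)"
proof -
  let ?r = "residual V q e w"
  have "ip V ?r ?r = ip V w ?r - (\<Sum>i<q. ip V w (e i) * ip V (e i) ?r)"
    unfolding residual_def[of V q e w, abs_def]
    by (simp add: ip_diff_left ip_sum_left)
  also have "(\<Sum>i<q. ip V w (e i) * ip V (e i) ?r) = 0"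
    using ip_residual[OF assms] by (intro sum.neutral) (simp add: ip_commute[of V _ ?r])
  also have "ip V w ?r = ip V ?r w" by (rule ip_commute)
  also have "ip V ?r w = ip V w w - (\<Sum>i<q. ip V w (e i) * ip V (e i) w)"
    unfolding residual_def[of V q e w, abs_def]
    by (simp add: ip_diff_left ip_sum_left)
  also have "(\<Sum>i<q. ip V w (e i) * ip V (e i) w) = (\<Sum>i<q. (ip V w (e i))\<^sup>2)"
    by (intro sum.cong refl) (metis ip_commute power2_eq_square)
  finally show ?thesis by simp
qed

lemma bessel: "orthonormal_on V q e \<Longrightarrow> (\<Sum>i<q. (ip V w (e i))\<^sup>2) \<le> ip V w w"
  using ip_self_residual[of V q e w] ip_self_nonneg[of V "residual V q e w"] by linarith

text \<open>Adding the normalised residual of a badly approximated combination of the rows of R to the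
  orthonormal family captures a fixed part of the squared Hilbert-Schmidt norm of R, so a
  maximal such family is short.\<close>

lemma finite_rank_approximation:
  fixes R :: "'a \<Rightarrow> 'a \<Rightarrow> real"
  assumes F: "\<And>f. f \<in> F \<Longrightarrow> ip V f f \<le> l" and l: "l \<ge> 0" and tau: "\<tau> > 0"
  shows "\<exists>q e. orthonormal_on V q e \<and> real q * \<tau> \<le> l * (\<Sum>x\<in>V. ip V (R x) (R x)) \<and>
    (\<forall>f\<in>F. ip V (residual V q e (\<lambda>y. \<Sum>x\<in>V. f x * R x y)) (residual V q e (\<lambda>y. \<Sum>x\<in>V. f x * R x y)) < \<tau>)"
proof -
  define S where "S = (\<Sum>x\<in>V. ip V (R x) (R x))"
  \<comment> \<open>\<open>P q\<close> asks for \<open>q\<close> orthonormal directions, each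
    carrying at least \<open>\<tau>\<close> out of the total \<open>l * S\<close>. By Bessel's
    inequality together they carry at most that total, which bounds \<open>q\<close>.\<close>
  define P where "P q \<longleftrightarrow> (\<exists>e. orthonormal_on V q e \<and> (\<forall>i<q. \<tau> \<le> l * (\<Sum>x\<in>V. (ip V (R x) (e i))\<^sup>2)))" for q
  have bound: "real q * \<tau> \<le> l * S" if "P q" for q
  proof -
    from that obtain e where e': "orthonormal_on V q e \<and> (\<forall>i<q. \<tau> \<le> l * (\<Sum>x\<in>V. (ip V (R x) (e i))\<^sup>2))"
      unfolding P_def by (rule exE)
    then have e: "orthonormal_on V q e" "\<And>i. i < q \<Longrightarrow> \<tau> \<le> l * (\<Sum>x\<in>V. (ip V (R x) (e i))\<^sup>2)"
      by simp_all
    have "real q * \<tau> = (\<Sum>i<q. \<tau>)" by simp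
    also have "\<dots> \<le> (\<Sum>i<q. l * (\<Sum>x\<in>V. (ip V (R x) (e i))\<^sup>2))"
      using e(2) by (intro sum_mono) auto
    also have "\<dots> = l * (\<Sum>x\<in>V. \<Sum>i<q. (ip V (R x) (e i))\<^sup>2)"
      unfolding sum_distrib_left[symmetric] by (subst sum.swap) simp
    also have "\<dots> \<le> l * S"
      unfolding S_def using l by (intro mult_left_mono sum_mono bessel e(1))
    finally show ?thesis .
  qed
  have P0: "P 0" unfolding P_def orthonormal_on_def by simp
  have "q \<le> nat \<lfloor>l * S / \<tau>\<rfloor>" if "P q" for q
    using bound[OF that] tau by (simp add: le_nat_floor pos_le_divide_eq)
  then have qmax: "P (GREATEST q. P q)" "\<And>k. P k \<Longrightarrow> k \<le> (GREATEST q. P q)"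
    using P0 GreatestI_nat Greatest_le_nat by blast+
  then obtain q where q: "P q" "\<And>k. P k \<Longrightarrow> k \<le> q" by blast
  from q(1) obtain e where e': "orthonormal_on V q e \<and> (\<forall>i<q. \<tau> \<le> l * (\<Sum>x\<in>V. (ip V (R x) (e i))\<^sup>2))"
    unfolding P_def by (rule exE)
  then have e: "orthonormal_on V q e" "\<And>i. i < q \<Longrightarrow> \<tau> \<le> l * (\<Sum>x\<in>V. (ip V (R x) (e i))\<^sup>2)"
    by simp_all
  have "ip V (residual V q e (\<lambda>y. \<Sum>x\<in>V. f x * R x y)) (residual V q e (\<lambda>y. \<Sum>x\<in>V. f x * R x y)) < \<tau>"
    if f: "f \<in> F" for f
  proof (rule ccontr)
    define G where "G = residual V q e (\<lambda>y. \<Sum>x\<in>V. f x * R x y)"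
    define N where "N = ip V G G"
    assume "\<not> ?thesis"
    then have N: "N \<ge> \<tau>" unfolding N_def G_def by simp
    then have N_pos: "N > 0" using tau by linarith
    define g where "g y = G y / sqrt N" for y
    define e' where "e' i = (if i = q then g else e i)" for i
    have g_ip: "ip V w g = ip V w G / sqrt N" "ip V g w = ip V G w / sqrt N" for w
      unfolding ip_def g_def by (simp_all add: sum_divide_distrib)
    have gg: "ip V g g = 1"
      unfolding g_ip N_def[symmetric] using N_pos by (simp add: field_simps)
    have ge: "ip V g (e i) = 0" "ip V (e i) g = 0" if "i < q" for i
      using ip_residual[OF e(1) that] unfolding g_ip ip_commute[of V "e i" G] by (simp_all add: G_def)
    have on: "orthonormal_on V (Suc q) e'"
      using e(1) gg ge unfolding orthonormal_on_def e'_def by (auto simp: less_Suc_eq)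
    \<comment> \<open>A vector and its residual differ by a combination of the \<open>e i\<close>,
      all orthogonal to \<open>g\<close>.\<close>
    have Rg: "ip V (residual V q e w) g = ip V w g" for w
    proof -
      have "(\<Sum>i<q. ip V w (e i) * ip V (e i) g) = 0" using ge by (intro sum.neutral) auto
      then show ?thesis
        unfolding residual_def[of V q e w, abs_def] by (simp add: ip_diff_left ip_sum_left)
    qed
    \<comment> \<open>\<open>sqrt N\<close> is the coordinate along \<open>g\<close> of the badly
      approximated combination. Moving the inner product onto the rows \<open>R x\<close> and
      applying Cauchy-Schwarz shows that \<open>g\<close> meets the demand of \<open>P\<close> on a
      new direction.\<close>
    have "sqrt N = N / sqrt N" using N_pos by (simp add: real_div_sqrt)
    also have "\<dots> = ip V G g" unfolding g_ip N_def by simp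
    also have "\<dots> = ip V (\<lambda>y. \<Sum>x\<in>V. f x * R x y) g" unfolding G_def by (rule Rg)
    also have "\<dots> = ip V f (\<lambda>x. ip V (R x) g)" unfolding ip_sum_left by (simp add: ip_def)
    finally have "N = (ip V f (\<lambda>x. ip V (R x) g))\<^sup>2" using N_pos
      by (metis less_imp_le real_sqrt_pow2)
    also have "\<dots> \<le> ip V f f * (\<Sum>x\<in>V. (ip V (R x) g)\<^sup>2)"
      using Cauchy_Schwarz_ip[of V f "\<lambda>x. ip V (R x) g"]
      by (simp add: ip_def[of V "\<lambda>x. ip V (R x) g"] power2_eq_square)
    also have "\<dots> \<le> l * (\<Sum>x\<in>V. (ip V (R x) g)\<^sup>2)"
      using F[OF f] by (intro mult_right_mono) (auto intro: sum_nonneg)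
    finally have "\<tau> \<le> l * (\<Sum>x\<in>V. (ip V (R x) g)\<^sup>2)" using N by linarith
    then have "\<forall>i<Suc q. \<tau> \<le> l * (\<Sum>x\<in>V. (ip V (R x) (e' i))\<^sup>2)"
      using e(2) unfolding e'_def by (auto simp: less_Suc_eq)
    then have "P (Suc q)" unfolding P_def using on by blast
    then show False using q(2) by fastforce
  qed
  then show ?thesis using bound[OF q(1)] e(1) unfolding S_def by blast
qed

text \<open>The coordinates of a vertex form one of \<open>card A ^ q\<close> vectors, and numbering
  these vectors turns them into colours.\<close>

lemma colourable_by_grid:
  assumes fin_A: "finite A" and g: "\<And>x i. x \<in> V \<Longrightarrow> i < q \<Longrightarrow> g x i \<in> A"
    and sep: "\<And>x y. x \<in> V \<Longrightarrow> y \<in> V \<Longrightarrow> (x, y) \<in> E \<Longrightarrow> \<exists>i<q. g x i \<noteq> g y i"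
  shows "colourable E V (card A ^ q)"
proof -
  let ?T = "PiE {..<q} (\<lambda>_. A)"
  have fin: "finite ?T" using fin_A by (intro finite_PiE) auto
  have card: "card ?T = card A ^ q" by (simp add: card_PiE)
  obtain h where h: "bij_betw h ?T {0..<card ?T}"
    using ex_bij_betw_finite_nat[OF fin] by blast
  define k where "k x = restrict (g x) {..<q}" for x
  have kT: "k x \<in> ?T" if "x \<in> V" for x using g that unfolding k_def by auto
  have "h (k x) < card A ^ q" if "x \<in> V" for x
    using kT[OF that] h card unfolding bij_betw_def by auto
  moreover have "h (k x) \<noteq> h (k y)" if xy: "x \<in> V" "y \<in> V" "(x, y) \<in> E" for x y
  proof
    assume "h (k x) = h (k y)"
    then have "k x = k y" using h kT xy unfolding bij_betw_def inj_on_def by blast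
    moreover obtain i where "i < q" "g x i \<noteq> g y i" using sep xy by blast
    ultimately show False unfolding k_def by (metis lessThan_iff restrict_apply')
  qed
  ultimately show ?thesis unfolding colourable_def by (intro exI[of _ "\<lambda>x. h (k x)"]) simp
qed

text \<open>All entries are \<open>1 / 2\<close> up to sign, so the rows of the shifted adjacency
  matrix have the same norm whatever the degrees are.\<close>

lemma ip_signs: "ip V (\<lambda>y. of_bool (P y) - 1 / 2) (\<lambda>y. of_bool (P y) - 1 / 2) = real (card V) / 4"
proof -
  have "(of_bool (P y) - 1 / 2) * (of_bool (P y) - 1 / 2) = (1 / 4 :: real)" for y
    by (cases "P y") auto
  then show ?thesis unfolding ip_def by (simp only: sum_constant mult_1_right times_divide_eq_right)
qed

section \<open>Codegree functions and classes of vertices\<close>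

context dense_triangle_free
begin

text \<open>A vertex of \<open>P\<close> has no neighbour in \<open>P\<close>, and likewise for
  \<open>Q\<close>, so on \<open>P \<union> Q\<close> the codegree difference counts, up to sign,
  all neighbours in \<open>P \<union> Q\<close>. For most of these vertices the count is small. They
  are joined to more than half of the remaining set \<open>W\<close>, so no two of them are
  adjacent.\<close>

lemma close_nbrs_stable_set:
  assumes uv: "(u, v) \<in> E" and large: "1000 * (s + 1) \<le> real (card V)"
    and P: "P \<subseteq> E `` {u}" "card P = d" and Q: "Q \<subseteq> E `` {v}" "card Q = d"
    and d: "real (card V) / 3 - s - 1 \<le> real d"
    and close: "(\<Sum>y\<in>V. (real (card (E `` {y} \<inter> P)) - real (card (E `` {y} \<inter> Q)))\<^sup>2)
      \<le> real (card V) ^ 3 / 753"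
  shows "\<exists>B. B \<subseteq> V \<and> stable_set E B \<and> real (card B) \<ge> (2 / 3 - 1 / 16) * real (card V)"
proof -
  define n where "n = real (card V)"
  have large': "1000 * s + 1000 \<le> n" using large n_def by simp
  then have n_pos: "n > 0" using s_pos by linarith
  have fin: "finite P" "finite Q" using P(1) Q(1) finite_nbrs finite_subset by blast+
  have sub: "P \<subseteq> V" "Q \<subseteq> V" using P(1) Q(1) nbrs_sub by blast+
  have disj: "P \<inter> Q = {}" using nbrs_disjoint[OF uv] P(1) Q(1) by blast
  have PP: "E `` {y} \<inter> P = {}" if "y \<in> P" for y
    using that P(1) no_triangle by blast
  have QQ: "E `` {y} \<inter> Q = {}" if "y \<in> Q" for y
    using that Q(1) no_triangle by blast
  define W where "W = V - (P \<union> Q)"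
  have cW: "real (card W) = n - 2 * real d"
  proof -
    have "card (P \<union> Q) = 2 * d" using fin disj P(2) Q(2) by (simp add: card_Un_disjoint)
    moreover have "card (P \<union> Q) \<le> card V" using sub finite_V by (intro card_mono) auto
    moreover have "card W = card V - card (P \<union> Q)"
      unfolding W_def using sub fin by (intro card_Diff_subset) auto
    ultimately show ?thesis unfolding n_def by simp
  qed
  define G where "G y = real (card (E `` {y} \<inter> P)) - real (card (E `` {y} \<inter> Q))" for y
  \<comment> \<open>\<open>4 / 25\<close> lies just below \<open>1 / 6\<close>, so that
    \<open>n / 3 - 4 / 25 * n\<close> exceeds half of \<open>n / 3\<close>, roughly the size of
    \<open>W\<close>, with room for the terms in \<open>s\<close>.\<close>
  define X where "X = {y \<in> P \<union> Q. \<bar>G y\<bar> < 4 / 25 * n}"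
  have W_large: "real (card (E `` {y} \<inter> W)) > n / 3 - s - 4 / 25 * n" if y: "y \<in> X" for y
  proof -
    have "card (E `` {y} \<inter> P \<union> E `` {y} \<inter> Q) = card (E `` {y} \<inter> P) + card (E `` {y} \<inter> Q)"
      using disj fin by (intro card_Un_disjoint) auto
    moreover have "card (E `` {y}) = card ((E `` {y} \<inter> P \<union> E `` {y} \<inter> Q) \<union> E `` {y} \<inter> W)"
      using nbrs_sub[of y] by (intro arg_cong[where f = card]) (auto simp: W_def)
    moreover have "\<dots> \<le> card (E `` {y} \<inter> P \<union> E `` {y} \<inter> Q) + card (E `` {y} \<inter> W)"
      by (rule card_Un_le)
    ultimately have "real (card (E `` {y})) \<le> real (card (E `` {y} \<inter> P)) + real (card (E `` {y} \<inter> Q))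
        + real (card (E `` {y} \<inter> W))" by linarith
    moreover have "real (card (E `` {y} \<inter> P)) + real (card (E `` {y} \<inter> Q)) = \<bar>G y\<bar>"
      using y PP[of y] QQ[of y] unfolding X_def G_def by auto
    moreover have "\<bar>G y\<bar> < 4 / 25 * n" using y X_def by simp
    moreover have "n / 3 - s \<le> real (card (E `` {y}))"
      using degree_ge[of y] y sub unfolding X_def n_def by auto
    ultimately show ?thesis by linarith
  qed
  have stable: "stable_set E X"
    unfolding stable_set_def
  proof (intro ballI notI)
    fix y z assume yz: "y \<in> X" "z \<in> X" "(y, z) \<in> E"
    have "E `` {y} \<inter> E `` {z} = {}" using nbrs_disjoint yz(3) .
    then have "card (E `` {y} \<inter> W \<union> E `` {z} \<inter> W) = card (E `` {y} \<inter> W) + card (E `` {z} \<inter> W)"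
      by (intro card_Un_disjoint) auto
    moreover have "card (E `` {y} \<inter> W \<union> E `` {z} \<inter> W) \<le> card W"
      using finite_V unfolding W_def by (intro card_mono) auto
    ultimately have "real (card (E `` {y} \<inter> W)) + real (card (E `` {z} \<inter> W)) \<le> n - 2 * real d"
      using cW by linarith
    then show False using W_large[OF yz(1)] W_large[OF yz(2)] d large' n_def by linarith
  qed
  define Y where "Y = (P \<union> Q) - X"
  have finY: "finite Y" "Y \<subseteq> V" using fin sub Y_def by auto
  \<comment> \<open>Chebyshev's inequality bounds \<open>card Y\<close> by about
    \<open>0.052 * n\<close>, which is less than the permitted loss of
    \<open>n / 16\<close>.\<close>
  have "(4 / 25 * n)\<^sup>2 * real (card Y) = (\<Sum>y\<in>Y. (4 / 25 * n)\<^sup>2)" by simp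
  also have "\<dots> \<le> (\<Sum>y\<in>Y. (G y)\<^sup>2)"
    using n_pos by (intro sum_mono) (auto simp: Y_def X_def not_less abs_le_square_iff[symmetric])
  also have "\<dots> \<le> (\<Sum>y\<in>V. (G y)\<^sup>2)"
    using finY finite_V by (intro sum_mono2) auto
  also have "\<dots> \<le> n ^ 3 / 753" using close unfolding G_def n_def .
  finally have "n\<^sup>2 * (16 / 625 * real (card Y)) \<le> n\<^sup>2 * (n / 753)"
    by (simp add: power2_eq_square power3_eq_cube)
  then have cY: "16 / 625 * real (card Y) \<le> n / 753"
    using n_pos by (simp only: mult_le_cancel_left_pos zero_less_power)
  have "card (P \<union> Q) = 2 * d" using fin disj P(2) Q(2) by (simp add: card_Un_disjoint)
  moreover have "card (P \<union> Q) \<le> card X + card Y"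
  proof -
    have "P \<union> Q = X \<union> Y" unfolding Y_def X_def by auto
    then show ?thesis by (metis card_Un_le)
  qed
  ultimately have "2 * real d \<le> real (card X) + real (card Y)" by linarith
  then have "real (card X) \<ge> 29 / 48 * n" using cY d large' n_def n_pos by linarith
  moreover have "X \<subseteq> V" using sub unfolding X_def by auto
  ultimately show ?thesis using stable unfolding n_def by (intro exI[of _ X]) auto
qed

text \<open>Vertices are classified by rounded coordinates of their neighbourhood in a bounded
  orthonormal family; vertices in the same class have almost the same codegree function.\<close>

lemma colourable_or_large_stable_set:
  assumes large: "1000 * (s + 1) \<le> real (card V)"
  shows "colourable E V (10 ^ 390) \<or>
    (\<exists>B. B \<subseteq> V \<and> stable_set E B \<and> real (card B) \<ge> (2 / 3 - 1 / 16) * real (card V))"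
proof -
  define n where "n = real (card V)"
  have large': "1000 * s + 1000 \<le> n" using large n_def by simp
  then have n_pos: "n > 0" using s_pos by linarith
  \<comment> \<open>All neighbourhoods are cut down to the same size \<open>d\<close>, so that the
    shift by \<open>1 / 2\<close> in \<open>R\<close> cancels in differences.\<close>
  define d where "d = nat \<lfloor>n / 3 - s\<rfloor>"
  have "n / 3 - s > 0" using large' s_pos by linarith
  then have d_le: "real d \<le> n / 3 - s" and d_ge: "n / 3 - s - 1 \<le> real d"
    unfolding d_def by linarith+
  have "\<exists>M. M \<subseteq> E `` {u} \<and> card M = d" if "u \<in> V" for u
  proof -
    have "d \<le> card (E `` {u})" using d_le degree_ge[OF that] n_def by linarith
    then show ?thesis by (meson obtain_subset_with_card_n)
  qed
  then obtain M where M: "\<And>u. u \<in> V \<Longrightarrow> M u \<subseteq> E `` {u}" "\<And>u. u \<in> V \<Longrightarrow> card (M u) = d"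
    by metis
  have MV: "M u \<subseteq> V" if "u \<in> V" for u using M(1)[OF that] nbrs_sub by blast
  define f :: "'a \<Rightarrow> 'a \<Rightarrow> real" where "f u x = of_bool (x \<in> M u)" for u x
  have sum_f: "(\<Sum>x\<in>V. f u x * g x) = (\<Sum>x\<in>M u. g x)" if "u \<in> V" for u g
    unfolding f_def using MV[OF that] finite_V
    by (simp add: of_bool_def if_distrib[where f = "\<lambda>a. a * _"] sum.If_cases Int_absorb1 cong: if_cong)
  define R :: "'a \<Rightarrow> 'a \<Rightarrow> real" where "R x y = of_bool ((x, y) \<in> E) - 1 / 2" for x y
  have RR: "ip V (R x) (R x) = n / 4" for x
    unfolding R_def[abs_def] ip_signs n_def by simp
  define D where "D u v x = f u x - f v x" for u v x
  define F where "F = {D u v |u v. u \<in> V \<and> v \<in> V}"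
  have "ip V g g \<le> 2 * n / 3" if g: "g \<in> F" for g
  proof -
    from g obtain u v where uv: "u \<in> V" "v \<in> V" "g = D u v" unfolding F_def by blast
    have "ip V g g \<le> (\<Sum>x\<in>V. f u x * 1 + f v x * 1)"
      unfolding ip_def uv(3) D_def f_def by (intro sum_mono) auto
    also have "\<dots> = 2 * real d" unfolding sum.distrib sum_f[OF uv(1)] sum_f[OF uv(2)]
      using M(2) uv by simp
    finally show ?thesis using d_le s_pos by linarith
  qed
  moreover have "2 * n / 3 \<ge> 0" "n ^ 3 / 780 > 0" using n_pos by auto
  ultimately obtain q e where on: "orthonormal_on V q e"
    and q: "real q * (n ^ 3 / 780) \<le> 2 * n / 3 * (\<Sum>x\<in>V. ip V (R x) (R x))"
    and res: "\<forall>f\<in>F. ip V (residual V q e (\<lambda>y. \<Sum>x\<in>V. f x * R x y))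
      (residual V q e (\<lambda>y. \<Sum>x\<in>V. f x * R x y)) < n ^ 3 / 780"
    using finite_rank_approximation[of F V "2 * n / 3" "n ^ 3 / 780" R] by blast
  \<comment> \<open>The bound on \<open>q\<close> now reads
    \<open>q * (n ^ 3 / 780) \<le> n ^ 3 / 6\<close>, and \<open>780 = 6 * 130\<close>.\<close>
  have "(\<Sum>x\<in>V. ip V (R x) (R x)) = n * (n / 4)" unfolding RR n_def by simp
  then have "n ^ 3 * (real q / 780) \<le> n ^ 3 * (1 / 6)"
    using q by (simp only:) (simp add: power3_eq_cube algebra_simps)
  then have "real q / 780 \<le> 1 / 6" using n_pos by (simp only: mult_le_cancel_left_pos zero_less_power)
  then have q130: "q \<le> 130" by simp
  \<comment> \<open>This is the coordinate along \<open>e i\<close> of the sum of the rows over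
    \<open>M u\<close>, with the summations exchanged.\<close>
  define k where "k u i = ip V (f u) (\<lambda>x. ip V (R x) (e i))" for u i
  have k_bound: "(k u i)\<^sup>2 \<le> n ^ 3 / 12" if "u \<in> V" "i < q" for u i
  proof -
    have "(ip V (R x) (e i))\<^sup>2 \<le> n / 4" for x
    proof -
      have "(ip V (R x) (e i))\<^sup>2 \<le> (\<Sum>i<q. (ip V (R x) (e i))\<^sup>2)"
        using that(2) by (intro member_le_sum) auto
      then show ?thesis using bessel[OF on, of "R x"] RR by simp
    qed
    then have "(\<Sum>x\<in>V. (ip V (R x) (e i))\<^sup>2) \<le> (\<Sum>x\<in>V. n / 4)" by (intro sum_mono)
    also have "\<dots> = n * (n / 4)" unfolding n_def by simp
    finally have 1: "(\<Sum>x\<in>V. (ip V (R x) (e i))\<^sup>2) \<le> n * (n / 4)" .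
    have "ip V (f u) (f u) = (\<Sum>x\<in>V. f u x * 1)"
      unfolding ip_def f_def by (intro sum.cong) auto
    then have 2: "ip V (f u) (f u) = real d" unfolding sum_f[OF that(1)] using M(2) that by simp
    have "(k u i)\<^sup>2 \<le> ip V (f u) (f u) * (\<Sum>x\<in>V. (ip V (R x) (e i))\<^sup>2)"
      using Cauchy_Schwarz_ip[of V "f u" "\<lambda>x. ip V (R x) (e i)"]
      unfolding k_def ip_def[of V "\<lambda>x. ip V (R x) (e i)"] by (simp add: power2_eq_square)
    also have "\<dots> \<le> (n / 3) * (n * (n / 4))"
      unfolding 2 using d_le s_pos n_pos by (intro mult_mono 1) (auto intro: sum_nonneg)
    finally show ?thesis by (simp add: power3_eq_cube)
  qed
  \<comment> \<open>By \<open>k_bound\<close> the quotients \<open>k u i / h\<close> are at most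
    \<open>1700 / sqrt 12\<close>, about 491, in absolute value, so 1000 cells per coordinate
    suffice. The rounding error \<open>130 * h\<^sup>2\<close> fits between
    \<open>n ^ 3 / 780\<close> and \<open>n ^ 3 / 753\<close>.\<close>
  define h where "h = sqrt (n ^ 3) / 1700"
  have h_pos: "h > 0" and h2: "h\<^sup>2 = n ^ 3 / 2890000"
    unfolding h_def using n_pos by (auto simp: power_divide)
  define c where "c u i = \<lfloor>k u i / h\<rfloor>" for u i
  have c_range: "c u i \<in> {-500..<500}" if "u \<in> V" "i < q" for u i
  proof -
    have "(k u i)\<^sup>2 < (500 * h)\<^sup>2"
    proof -
      have "n ^ 3 / 12 < 250000 * (n ^ 3 / 2890000)" using n_pos by simp
      also have "\<dots> = (500 * h)\<^sup>2" unfolding power_mult_distrib h2 by simp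
      finally show ?thesis using k_bound[OF that] by linarith
    qed
    then have "\<bar>k u i\<bar>\<^sup>2 < (500 * h)\<^sup>2" by (simp only: power2_abs)
    then have "\<bar>k u i\<bar> < 500 * h"
      by (rule power2_less_imp_less) (use h_pos in simp)
    then have "\<bar>k u i / h\<bar> < 500" using h_pos by (simp add: abs_divide pos_divide_less_eq)
    then have "- 500 \<le> k u i / h" "k u i / h < 500" by linarith+
    then show ?thesis unfolding c_def by (simp add: floor_less_iff le_floor_iff)
  qed
  show ?thesis
  proof (cases "\<exists>u\<in>V. \<exists>v\<in>V. (u, v) \<in> E \<and> (\<forall>i<q. c u i = c v i)")
    case False
    then have "colourable E V (card {-500..<500 :: int} ^ q)"
      using c_range by (intro colourable_by_grid[where g = c]) auto
    moreover have "(1000 :: nat) ^ q \<le> 1000 ^ 130" using q130 by (intro power_increasing) auto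
    moreover have "(1000 :: nat) ^ 130 = 10 ^ 390"
      using power_mult[of "10 :: nat" 3 130] by simp
    moreover have "card {-500..<500 :: int} = 1000" by simp
    ultimately have "colourable E V (10 ^ 390)" using colourable_mono by metis
    then show ?thesis ..
  next
    case True
    then obtain u v where uv: "u \<in> V" "v \<in> V" "(u, v) \<in> E" "\<And>i. i < q \<Longrightarrow> c u i = c v i" by blast
    define G where "G y = (\<Sum>x\<in>V. D u v x * R x y)" for y
    have G_e: "ip V G (e i) = k u i - k v i" for i
      unfolding G_def[abs_def] ip_sum_left k_def D_def ip_def[of V "f u"] ip_def[of V "f v"]
      by (simp add: algebra_simps sum_subtractf)
    have dk: "(k u i - k v i)\<^sup>2 \<le> h\<^sup>2" if "i < q" for i
    proof -
      have "\<bar>k u i / h - k v i / h\<bar> \<le> 1"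
        using uv(4)[OF that] unfolding c_def by linarith
      then have "\<bar>k u i - k v i\<bar> \<le> h" using h_pos by (simp add: diff_divide_distrib[symmetric])
      then show ?thesis by (metis abs_le_square_iff abs_of_pos h_pos)
    qed
    have "ip V G G = ip V (residual V q e G) (residual V q e G) + (\<Sum>i<q. (k u i - k v i)\<^sup>2)"
      using ip_self_residual[OF on, of G] unfolding G_e .
    also have "ip V (residual V q e G) (residual V q e G) \<le> n ^ 3 / 780"
      using res uv(1,2) unfolding F_def G_def[abs_def] by (auto intro: less_imp_le)
    also have "(\<Sum>i<q. (k u i - k v i)\<^sup>2) \<le> (\<Sum>i<q. h\<^sup>2)"
      using dk by (intro sum_mono) auto
    also have "(\<Sum>i<q. h\<^sup>2) \<le> 130 * (n ^ 3 / 2890000)"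
      unfolding h2 using q130 n_pos by (simp add: mult_right_mono divide_right_mono)
    finally have "ip V G G \<le> n ^ 3 / 780 + 130 * (n ^ 3 / 2890000)" by simp
    moreover have "n ^ 3 \<ge> 0" using n_pos by simp
    ultimately have GG: "ip V G G \<le> n ^ 3 / 753" by linarith
    have G_card: "G y = real (card (E `` {y} \<inter> M u)) - real (card (E `` {y} \<inter> M v))" for y
    proof -
      have sR: "(\<Sum>x\<in>M w. R x y) = real (card (E `` {y} \<inter> M w)) - real d / 2" if w: "w \<in> V" for w
      proof -
        have fin: "finite (M w)" using MV[OF w] finite_V finite_subset by blast
        have "(\<Sum>x\<in>M w. R x y) = (\<Sum>x\<in>M w. of_bool ((x, y) \<in> E)) - real d / 2"
          unfolding R_def sum_subtractf using M(2)[OF w] by simp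
        also have "(\<Sum>x\<in>M w. of_bool ((x, y) \<in> E)) = real (card (M w \<inter> {x. (x, y) \<in> E}))"
          using fin by (simp add: of_bool_def sum.If_cases)
        also have "M w \<inter> {x. (x, y) \<in> E} = E `` {y} \<inter> M w" using edge_sym by auto
        finally show ?thesis .
      qed
      have "G y = (\<Sum>x\<in>V. f u x * R x y) - (\<Sum>x\<in>V. f v x * R x y)"
        unfolding G_def D_def by (simp add: algebra_simps sum_subtractf)
      then show ?thesis unfolding sum_f[OF uv(1)] sum_f[OF uv(2)] sR[OF uv(1)] sR[OF uv(2)] by simp
    qed
    have "(\<Sum>y\<in>V. (real (card (E `` {y} \<inter> M u)) - real (card (E `` {y} \<inter> M v)))\<^sup>2) \<le> real (card V) ^ 3 / 753"
      using GG unfolding ip_def G_card n_def by (simp add: power2_eq_square)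
    then show ?thesis
      using close_nbrs_stable_set[OF uv(3) large M(1)[OF uv(1)] M(2)[OF uv(1)] M(1)[OF uv(2)] M(2)[OF uv(2)]]
        d_ge unfolding n_def by blast
  qed
qed

end

section \<open>Combination of the two cases and choice of the parameters\<close>

context dense_triangle_free
begin

lemma colourable_if_slow_growth:
  assumes large: "1000 * (s + 1) \<le> real (card V)"
    and m: "m > 0" "card V < m ^ r" "real (card V) < (1 + 1 / real m) ^ q"
    and q: "100 * (4 * real q + 5) * s < real (card V)"
  shows "colourable E V (max (10 ^ 390) (r + 3))"
  using colourable_or_large_stable_set[OF large]
proof
  assume "colourable E V (10 ^ 390)"
  then show ?thesis by (rule colourable_mono) simp
next
  assume "\<exists>B. B \<subseteq> V \<and> stable_set E B \<and> real (card B) \<ge> (2 / 3 - 1 / 16) * real (card V)"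
  then have "colourable E V (r + 3)" using colourable_if_large_stable_set m q by blast
  then show ?thesis by (rule colourable_mono) simp
qed

end

text \<open>\<open>m\<close> is slightly above \<open>n powr (1 / k)\<close> and \<open>q\<close> is
  about \<open>m * log 2 n\<close>, which suffices since \<open>(1 + 1 / m) ^ m\<close> is at least
  2 by Bernoulli. The last condition compares \<open>n powr (1 / k + b) * log 2 n\<close>, up to
  constants, with \<open>n\<close>; here \<open>1 / k + b < 1\<close> follows from
  \<open>k \<ge> 2\<close> and \<open>\<epsilon> > 0\<close>.\<close>

lemma eventually_slow_growth:
  fixes k :: nat and \<epsilon> :: real
  assumes k: "k \<ge> 2" and eps: "\<epsilon> > 0" and b: "b = 1 - (1 + \<epsilon>) / (real k + \<epsilon>)"
  shows "\<forall>\<^sub>F n in sequentially. 1000 * (real n powr b + 1) \<le> real n \<and>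
    (\<exists>m q. m > 0 \<and> n < m ^ k \<and> real n < (1 + 1 / real m) ^ q \<and>
      100 * (4 * real q + 5) * real n powr b < real n)"
proof -
  define a where "a = 1 / real k"
  have a0: "a > 0" using k a_def by simp
  have b0: "b > 0" unfolding b using k eps by (simp add: field_simps)
  have "a < (1 + \<epsilon>) / (real k + \<epsilon>)"
    unfolding a_def using k eps by (simp add: field_simps)
  then have ab: "a + b < 1" unfolding b by simp
  have b1: "b < 1" using ab a0 by simp
  have "\<forall>\<^sub>F n::nat in sequentially. 1000 * (real n powr b + 1) \<le> real n"
    using b0 b1 by real_asymp
  moreover have "\<forall>\<^sub>F n::nat in sequentially.
      100 * (4 * ((real n powr a + 2) * (log 2 (real n) + 2)) + 5) * real n powr b < real n"
    using a0 b0 ab by real_asymp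
  moreover have "\<forall>\<^sub>F n::nat in sequentially. n \<ge> 1" by (rule eventually_ge_at_top)
  ultimately show ?thesis
  proof eventually_elim
    case (elim n)
    have n: "real n \<ge> 1" using elim by simp
    define m where "m = nat \<lceil>real n powr a\<rceil> + 1"
    define j where "j = nat \<lceil>log 2 (real n)\<rceil> + 1"
    have log0: "log 2 (real n) \<ge> 0" using n by simp
    have m_gt: "real n powr a < real m" and m_le: "real m \<le> real n powr a + 2"
      unfolding m_def using powr_ge_zero[of "real n" a] by linarith+
    have j_gt: "log 2 (real n) < real j" and j_le: "real j \<le> log 2 (real n) + 2"
      unfolding j_def using log0 by linarith+
    have m0: "m > 0" unfolding m_def by simp
    have "real n = (real n powr a) ^ k"
      using n k by (simp add: a_def powr_powr flip: powr_realpow')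
    also have "\<dots> < real m ^ k"
      using m_gt k by (intro power_strict_mono) auto
    finally have "n < m ^ k" by (metis of_nat_less_iff of_nat_power)
    moreover have "real n < (1 + 1 / real m) ^ (m * j)"
    proof -
      have "2 \<le> (1 + 1 / real m) ^ m"
        using Bernoulli_inequality[of "1 / real m" m] m0 by (simp add: order_trans[of "- 1" 0])
      then have "2 ^ j \<le> ((1 + 1 / real m) ^ m) ^ j" by (intro power_mono) auto
      moreover have "real n < 2 ^ j"
        using j_gt n by (simp add: log_less_iff powr_realpow)
      ultimately show ?thesis unfolding power_mult by linarith
    qed
    moreover have "100 * (4 * real (m * j) + 5) * real n powr b < real n"
    proof -
      have "real (m * j) \<le> (real n powr a + 2) * (log 2 (real n) + 2)"
        unfolding of_nat_mult using m_le j_le by (intro mult_mono) auto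
      then have "100 * (4 * real (m * j) + 5) * real n powr b
          \<le> 100 * (4 * ((real n powr a + 2) * (log 2 (real n) + 2)) + 5) * real n powr b"
        by (intro mult_right_mono) auto
      then show ?thesis using elim(2) by linarith
    qed
    ultimately show ?case using elim(1) m0 by blast
  qed
qed

lemma chromatic_number_le: "proper_colouring F k c \<Longrightarrow> chromatic_number F \<le> k"
  unfolding chromatic_number_def by (rule Least_le) blast

section \<open>Shift graphs\<close>

definition shift_arc :: "nat \<Rightarrow> nat \<Rightarrow> bool" where
  "shift_arc x y \<longleftrightarrow> fst (prod_decode x) < snd (prod_decode x) \<and>
     snd (prod_decode x) = fst (prod_decode y) \<and> fst (prod_decode y) < snd (prod_decode y)"

text \<open>Coding pairs by numbers gives exactly \<open>n\<close> vertices for every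
  \<open>n\<close>; numbers whose pair is not increasing are isolated.\<close>

definition shift_graph :: "nat \<Rightarrow> nat pair_pre_digraph" where
  "shift_graph n = \<lparr>pverts = {..<n},
     parcs = {(x, y). x < n \<and> y < n \<and> (shift_arc x y \<or> shift_arc y x)}\<rparr>"

lemma pair_graph_shift_graph: "pair_graph (shift_graph n)"
proof
  have "parcs (shift_graph n) \<subseteq> {..<n} \<times> {..<n}" unfolding shift_graph_def by auto
  then show "finite (parcs (shift_graph n))" using finite_subset by blast
qed (auto simp: shift_graph_def shift_arc_def sym_def symmetric_def intro!: symI)

lemma triangle_free_shift_graph: "triangle_free (shift_graph n)"
  unfolding triangle_free_def shift_graph_def shift_arc_def by auto

text \<open>The colours \<open>C i\<close> on pairs starting in \<open>i\<close> determine
  \<open>i\<close>: for \<open>i < j\<close> the colour of \<open>(i, j)\<close> is in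
  \<open>C i\<close> but not in \<open>C j\<close>, as \<open>(i, j)\<close> is joined to every
  \<open>(j, l)\<close>. So \<open>2 ^ t\<close> points inject into the subsets of \<open>k\<close>
  colours.\<close>

lemma chromatic_number_shift_graph:
  "\<forall>\<^sub>F n in sequentially. t \<le> chromatic_number (shift_graph n)"
proof -
  define N :: nat where "N = 2 ^ t"
  have "finite (prod_encode ` ({..<N} \<times> {..<N}))" by simp
  then obtain M where M: "\<forall>x \<in> prod_encode ` ({..<N} \<times> {..<N}). x < M"
    unfolding finite_nat_set_iff_bounded by blast
  have "t \<le> chromatic_number (shift_graph n)" if n: "n \<ge> M" for n
  proof (rule ccontr)
    assume less: "\<not> ?thesis"
    define k where "k = chromatic_number (shift_graph n)"
    \<comment> \<open>Some proper colouring must exist for the \<open>LEAST\<close> in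
      \<open>chromatic_number\<close> to be attained.\<close>
    have "proper_colouring (shift_graph n) n id"
      unfolding proper_colouring_def shift_graph_def shift_arc_def by auto
    then have "\<exists>k c. proper_colouring (shift_graph n) k c" by blast
    then have "\<exists>c. proper_colouring (shift_graph n) k c"
      unfolding k_def chromatic_number_def by (rule LeastI_ex)
    then obtain c where c: "proper_colouring (shift_graph n) k c" by blast
    have small: "prod_encode (i, j) < n" if "i < N" "j < N" for i j
    proof -
      have "prod_encode (i, j) \<in> prod_encode ` ({..<N} \<times> {..<N})" using that by blast
      then show ?thesis using M n by (meson less_le_trans)
    qed
    define C where "C i = {c (prod_encode (i, j)) |j. i < j \<and> j < N}" for i
    have "c (prod_encode (i, j)) < k" if "i < N" "j < N" for i j
      using c small[OF that] unfolding proper_colouring_def shift_graph_def by auto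
    then have sub: "C ` {..<N} \<subseteq> Pow {..<k}" unfolding C_def by auto
    have neq: "C i \<noteq> C j" if ij: "i < j" "j < N" for i j
    proof
      assume "C i = C j"
      moreover have "c (prod_encode (i, j)) \<in> C i" using ij unfolding C_def by blast
      ultimately obtain l where l: "j < l" "l < N" "c (prod_encode (i, j)) = c (prod_encode (j, l))"
        unfolding C_def by auto
      have "(prod_encode (i, j), prod_encode (j, l)) \<in> parcs (shift_graph n)"
        using small[of i j] small[of j l] ij l unfolding shift_graph_def shift_arc_def by simp
      then show False using c l(3) unfolding proper_colouring_def by blast
    qed
    have "inj_on C {..<N}"
      by (rule linorder_inj_onI) (use neq in \<open>auto simp: nat_neq_iff\<close>)
    then have "N \<le> card (Pow {..<k})"
      using card_inj_on_le[OF _ sub] by simp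
    then have "(2::nat) ^ t \<le> 2 ^ k" unfolding N_def by (simp add: card_Pow)
    then have "t \<le> k" by simp
    then show False using less k_def by simp
  qed
  then show ?thesis unfolding eventually_sequentially by blast
qed

text \<open>This makes the \<open>Max\<close> in \<open>extremal_deficiency\<close> meaningful for
  large \<open>n\<close>.\<close>

lemma admissible_graphs_nonempty: "\<forall>\<^sub>F n in sequentially. admissible_graphs t n \<noteq> {}"
  using chromatic_number_shift_graph[of t]
proof eventually_elim
  case (elim n)
  then have "shift_graph n \<in> admissible_graphs t n"
    using pair_graph_shift_graph triangle_free_shift_graph
    unfolding admissible_graphs_def by (simp add: shift_graph_def)
  then show ?case by blast
qed

section \<open>Transfer to pair graphs and the final bound\<close>

lemma dense_triangle_free_graph:
  assumes F: "pair_graph F" "triangle_free F" and s: "s > 0"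
    and deg: "real (card (pverts F)) / 3 - s \<le> real (min_degree F)"
  shows "dense_triangle_free (pverts F) (parcs F) s"
proof -
  interpret pair_graph F by fact
  show ?thesis
  proof
    show "finite (pverts F)" by simp
    show sub: "parcs F \<subseteq> pverts F \<times> pverts F" using in_arcsD1 in_arcsD2 by auto
    show "sym (parcs F)" by (auto intro!: symI dest: arcs_symmetric)
    show "(x, z) \<notin> parcs F" if "(x, y) \<in> parcs F" "(y, z) \<in> parcs F" for x y z
      using F(2) that unfolding triangle_free_def by blast
    show "real (card (pverts F)) / 3 - s \<le> real (card (parcs F `` {x}))" if x: "x \<in> pverts F" for x
    proof -
      have "out_arcs F x = Pair x ` (parcs F `` {x})" by (auto simp: out_arcs_def)
      then have "out_degree F x = card (parcs F `` {x})"
        unfolding out_degree_def by (simp add: card_image inj_on_def)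
      moreover have "min_degree F \<le> out_degree F x"
        unfolding min_degree_def using x by (intro Min_le) auto
      ultimately show ?thesis using deg by linarith
    qed
    show "s > 0" by (rule s)
  qed
qed

lemma chromatic_number_le_colourable:
  assumes "pair_graph F" "colourable (parcs F) (pverts F) k"
  shows "chromatic_number F \<le> k"
proof -
  interpret pair_graph F by fact
  obtain c :: "'a \<Rightarrow> nat" where c: "\<forall>x\<in>pverts F. c x < k"
    "\<forall>x\<in>pverts F. \<forall>y\<in>pverts F. (x, y) \<in> parcs F \<longrightarrow> c x \<noteq> c y"
    using assms(2) unfolding colourable_def by blast
  then have "proper_colouring F k c"
    unfolding proper_colouring_def by (auto dest: in_arcsD1 in_arcsD2)
  then show ?thesis by (rule chromatic_number_le)
qed

theorem mainTheorem3:
  fixes t :: nat and \<epsilon> :: real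
  assumes "t \<ge> 10 ^ 391 + 3" and "\<epsilon> > 0"
  shows "\<forall>\<^sub>F n in sequentially.
           extremal_deficiency t n \<ge>
             real n powr (1 - (1 + \<epsilon>) / (real t - 10 ^ 391 - 1 + \<epsilon>))"
proof -
  define C :: nat where "C = 10 ^ 391"
  have C: "10 ^ 390 \<le> C" "10 \<le> C" unfolding C_def by simp_all
  define k where "k = t - C - 1"
  have tC: "C + 3 \<le> t" using assms(1) unfolding C_def .
  have k: "k \<ge> 2" "t = C + 1 + k" using tC k_def by simp_all
  define b where "b = 1 - (1 + \<epsilon>) / (real k + \<epsilon>)"
  have "real t - 10 ^ 391 - 1 + \<epsilon> = real k + \<epsilon>"
    unfolding k(2) C_def by simp
  then have b: "1 - (1 + \<epsilon>) / (real t - 10 ^ 391 - 1 + \<epsilon>) = b" unfolding b_def by simp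
  show ?thesis
    unfolding b
    using eventually_slow_growth[OF k(1) assms(2) b_def] admissible_graphs_nonempty[of t]
      eventually_gt_at_top[of 0]
  proof eventually_elim
    case (elim n)
    define s where "s = real n powr b"
    have s: "s > 0" using elim(3) s_def by simp
    \<comment> \<open>The maximum is attained, so it suffices to bound the minimum degree of the one
      graph \<open>F\<close>.\<close>
    have "Max (min_degree ` admissible_graphs t n) \<in> min_degree ` admissible_graphs t n"
      using elim(2) finite_min_degrees by (intro Max_in) auto
    then obtain F where F: "F \<in> admissible_graphs t n"
      and max: "min_degree F = Max (min_degree ` admissible_graphs t n)" by auto
    have F': "pair_graph F" "card (pverts F) = n" "triangle_free F" "t \<le> chromatic_number F"
      using F unfolding admissible_graphs_def by auto
    have "real (min_degree F) \<le> real n / 3 - s"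
    proof (rule ccontr)
      assume "\<not> ?thesis"
      then interpret dense_triangle_free "pverts F" "parcs F" s
        using F' s by (intro dense_triangle_free_graph) auto
      obtain m q where "m > 0" "n < m ^ k" "real n < (1 + 1 / real m) ^ q"
        "100 * (4 * real q + 5) * s < real n"
        using elim(1) unfolding s_def by blast
      then have "colourable (parcs F) (pverts F) (max (10 ^ 390) (k + 3))"
        using colourable_if_slow_growth[of m k q] elim(1) unfolding F'(2) s_def by blast
      then have "chromatic_number F \<le> max (10 ^ 390) (k + 3)"
        using chromatic_number_le_colourable F'(1) by blast
      \<comment> \<open>As \<open>t = C + 1 + k\<close> and \<open>C\<close> is at least 10 and at
        least \<open>10 ^ 390\<close>, both entries of the maximum are below
        \<open>t\<close>.\<close>
      also have "\<dots> < t" using C k(2) by simp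
      finally show False using F'(4) by simp
    qed
    then show ?case unfolding extremal_deficiency_def max s_def by simp
  qed
qed

end
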